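(* Let $\mathbf N$ be an algebra and assume that $\Gamma$ duplicates $\mathbf N$. If the topological structure $\underset{\sim}{\mathbf N}=(N;G,R,\mathscr T)$ yields a duality on $\mathscr B=\mathbb{ISP}(\mathbf N)$ with dual category $\mathscr Y=\mathbb{IS}_{\mathrm c}\mathbb P^+(\underset{\sim}{\mathbf N})$, then $\underset{\sim}{\mathbf N}^2$ yields a duality on $\mathscr A=\mathbb{ISP}(\mathsf P_\Gamma(\mathbf N))$, again with $\mathscr Y$ as the dual category. If the former duality is full, respectively strong, then the same is true of the latter.
   Context: **Duplication.** Let $\Sigma$ be the language of $\mathbf N$. Let $\Gamma$ be a set of pairs of $\Sigma$-terms such that for each $(t_1,t_2)\in\Gamma$ the terms $t_1,t_2$ have common even arity $2n_{(t_1,t_2)}$. View $\Gamma$ as an algebraic language in which $(t_1,t_2)$, written $[t_1,t_2]$ as an operation symbol, has arity $n_{(t_1,t_2)}$. For a $\Sigma$-algebra $\mathbf A$ in the variety generated by $\mathbf N$, $\mathsf P_\Gamma(\mathbf A)$ is the $\Gamma$-algebra with universe $A\times A$ and operations, for $n=n_{(t_1,t_2)}$, $$[t_1,t_2]((a_1,b_1),\dots,(a_n,b_n))=(t_1^{\mathbf A}(a_1,b_1,\dots,a_n,b_n),\,t_2^{\mathbf A}(a_1,b_1,\dots,a_n,b_n)).$$ With $\delta^N(x)=(x,x)$ and $\pi_1^N,\pi_2^N\colon N\times N\to N$ the projections, $\Gamma$ duplicates $\mathbf N$ if: (L) for each $n$-ary $f\in\Sigma$ and $i\in\{1,2\}$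 there is an $n$-ary $\Gamma$-term $t$ with $\pi_i^N\circ t^{\mathsf P_\Gamma(\mathbf N)}\circ(\delta^N)^n=f^{\mathbf N}$; (M) there is a binary $\Gamma$-term $v$ with $v^{\mathsf P_\Gamma(\mathbf N)}((a,b),(c,d))=(a,d)$ for all $a,b,c,d\in N$; (P) there is a unary $\Gamma$-term $s$ with $s^{\mathsf P_\Gamma(\mathbf N)}(a,b)=(b,a)$ for all $a,b\in N$. **Natural dualities.** Let $\mathbf M$ be an algebra carrying a compact Hausdorff topology $\mathscr T$ making it a topological algebra (discrete if $M$ is finite), and let $\mathscr A=\mathbb{ISP}(\mathbf M)$ (isomorphic copies of subalgebras of powers of $\mathbf M$), a category with all homomorphisms as morphisms. An alter ego for $\mathbf M$ is a topological structure $\underset{\sim}{\mathbf M}=(M;G,R,\mathscr T)$ where each $n$-ary $g\in G$ ($n\ge1$) is a continuous homomorphism $\mathbf M^n\to\mathbf M$, each nullary operation in $G$ is an element of $M$ forming a one-element subalgebra of $\mathbf M$, and each $n$-ary $r\in R$ ($n\ge1$) is the universe of a topologically closed subalgebra of $\mathbf M^n$. Powers $\underset{\sim}{\mathbf M}^S$ carry the product topology with operations and relations lifted pointwise; in particular on $\underset{\sim}{\mathbf N}^2$ an $n$-ary $r$ becomes the set of $((a_1,b_1),\dots,(a_n,b_n))$ with $(a_1,\dots,a_n)\in r$ and $(b_1,\dots,b_n)\in r$. $\mathbb{IS}_{\mathrm c}\mathbb P^+(\underset{\sim}{\mathbf M})$ is the class of isomorphic copies of closed substructures of non-empty powers of $\underset{\sim}{\mathbf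 M}$, the empty structure being included (when the type has no nullary operations); it is a category $\mathscr X$ with all continuous structure-preserving maps as morphisms. The contravariant hom-functors are $\mathsf D\colon\mathscr A\to\mathscr X$, $\mathsf D(\mathbf A)=\mathscr A(\mathbf A,\mathbf M)$ as a closed substructure of $\underset{\sim}{\mathbf M}^A$, and $\mathsf E\colon\mathscr X\to\mathscr A$, $\mathsf E(\mathbf X)=\mathscr X(\mathbf X,\underset{\sim}{\mathbf M})$ as a subalgebra of $\mathbf M^X$; both act on morphisms by precomposition. The evaluation maps are $e_{\mathbf A}\colon\mathbf A\to\mathsf E\mathsf D(\mathbf A)$, $e_{\mathbf A}(a)(x)=x(a)$, and $\varepsilon_{\mathbf X}\colon\mathbf X\to\mathsf D\mathsf E(\mathbf X)$, $\varepsilon_{\mathbf X}(x)(\alpha)=\alpha(x)$; these are always embeddings. The alter ego $\underset{\sim}{\mathbf M}$ yields a duality on $\mathscr A$, with dual category $\mathscr X$, if every $e_{\mathbf A}$ ($\mathbf A\in\mathscr A$) is surjective (so an isomorphism). The duality is full if moreover every $\varepsilon_{\mathbf X}$ ($\mathbf X\in\mathscr X$) is surjective and so an isomorphism. It is strong if it is full and $\underset{\sim}{\mathbf M}$ is injective in $\mathscr X$ (with respect to embeddings). In the claim, $\underset{\sim}{\mathbf N}$ is an alter ego for $\mathbf N$, and $\underset{\sim}{\mathbf N}^2$, whose universe is $N\times N$, is the alter ego used for $\mathsf P_\Gamma(\mathbf N)$. *)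

theory Defs
  imports "HOL-Analysis.Analysis"
begin

section \<open>Languages, algebras and terms\<close>

record 'f language =
  syms :: "'f set"
  arity :: "'f \<Rightarrow> nat"

record ('f, 'a) alg =
  car :: "'a set"
  interp :: "'f \<Rightarrow> 'a list \<Rightarrow> 'a"

definition tuples :: "nat \<Rightarrow> 'a set \<Rightarrow> 'a list set" where
  "tuples n A = {xs. length xs = n \<and> set xs \<subseteq> A}"

text \<open>Algebras, and hence subalgebras, are non-empty. The value of an operation outside the universe
  is irrelevant.\<close>

definition is_alg :: "'f language \<Rightarrow> ('f, 'a) alg \<Rightarrow> bool" where
  "is_alg L A \<longleftrightarrow> car A \<noteq> {} \<and>
     (\<forall>f\<in>syms L. \<forall>xs\<in>tuples (arity L f) (car A). interp A f xs \<in> car A)"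

definition subuniverse :: "'f language \<Rightarrow> ('f, 'a) alg \<Rightarrow> 'a set \<Rightarrow> bool" where
  "subuniverse L A U \<longleftrightarrow> U \<noteq> {} \<and> U \<subseteq> car A \<and>
     (\<forall>f\<in>syms L. \<forall>xs\<in>tuples (arity L f) U. interp A f xs \<in> U)"

definition subalg :: "('f, 'a) alg \<Rightarrow> 'a set \<Rightarrow> ('f, 'a) alg" where
  "subalg A U = A\<lparr>car := U\<rparr>"

text \<open>Elements of powers, and homomorphisms, are extensional functions, so that sets of them are
  sets of functions on the given domain.\<close>

definition alg_power :: "('f, 'a) alg \<Rightarrow> 'i set \<Rightarrow> ('f, 'i \<Rightarrow> 'a) alg" where
  "alg_power M S = \<lparr>car = (\<Pi>\<^sub>E i\<in>S. car M),
                    interp = (\<lambda>f xs. \<lambda>i\<in>S. interp M f (map (\<lambda>x. x i) xs))\<rparr>"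

definition alg_hom :: "'f language \<Rightarrow> ('f, 'a) alg \<Rightarrow> ('f, 'b) alg \<Rightarrow> ('a \<Rightarrow> 'b) set" where
  "alg_hom L A B = {h \<in> car A \<rightarrow>\<^sub>E car B.
     \<forall>f\<in>syms L. \<forall>xs\<in>tuples (arity L f) (car A). h (interp A f xs) = interp B f (map h xs)}"

definition alg_iso :: "'f language \<Rightarrow> ('f, 'a) alg \<Rightarrow> ('f, 'b) alg \<Rightarrow> bool" where
  "alg_iso L A B \<longleftrightarrow> (\<exists>h\<in>alg_hom L A B. bij_betw h (car A) (car B))"

text \<open>The members of \<open>\<bbbI>\<bbbS>\<bbbP>(M)\<close> whose universe is a subset of the type \<open>'c\<close>. The index
  set of the power is taken in the type \<open>'c \<Rightarrow> 'm\<close>. This loses nothing: an embedding into a power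
  with any index set can be re-indexed by its coordinate maps; see \<open>ISP_arbitrary_index\<close>.\<close>

definition ISP :: "'f language \<Rightarrow> ('f, 'm) alg \<Rightarrow> ('f, 'c) alg set" where
  "ISP L M = {A. is_alg L A \<and>
     (\<exists>(S :: ('c \<Rightarrow> 'm) set) U.
        subuniverse L (alg_power M S) U \<and> alg_iso L A (subalg (alg_power M S) U))}"

datatype 'f trm = Var nat | Op 'f "'f trm list"

text \<open>\<open>terms L k\<close> are the \<open>k\<close>-ary terms, with variables \<open>Var 0, \<dots>, Var (k - 1)\<close>.\<close>

inductive_set "terms" :: "'f language \<Rightarrow> nat \<Rightarrow> 'f trm set" for L k where
  "i < k \<Longrightarrow> Var i \<in> terms L k"
| "f \<in> syms L \<Longrightarrow> length ts = arity L f \<Longrightarrow> \<forall>t\<in>set ts. t \<in> terms L k \<Longrightarrow> Op f ts \<in> terms L k"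

primrec term_op :: "('f, 'a) alg \<Rightarrow> 'f trm \<Rightarrow> 'a list \<Rightarrow> 'a" where
  "term_op A (Var i) xs = xs ! i"
| "term_op A (Op f ts) xs = interp A f (map (\<lambda>t. term_op A t xs) ts)"

section \<open>Duplication\<close>

text \<open>A term together with its arity; the same syntactic term may be used with several arities.\<close>

type_synonym 'f arity_term = "nat \<times> 'f trm"

text \<open>A pair of terms of common arity \<open>k = 2 * n\<close> is an operation symbol of arity \<open>n\<close>.\<close>

definition dup_set :: "'f language \<Rightarrow> ('f arity_term \<times> 'f arity_term) set \<Rightarrow> bool" where
  "dup_set L \<Gamma> \<longleftrightarrow>
     (\<forall>((k1, t1), (k2, t2)) \<in> \<Gamma>. k1 = k2 \<and> even k1 \<and> t1 \<in> terms L k1 \<and> t2 \<in> terms L k2)"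

definition dup_language ::
  "('f arity_term \<times> 'f arity_term) set \<Rightarrow> ('f arity_term \<times> 'f arity_term) language" where
  "dup_language \<Gamma> = \<lparr>syms = \<Gamma>, arity = (\<lambda>((k, _), _). k div 2)\<rparr>"

text \<open>\<open>[(a\<^sub>1,b\<^sub>1),\<dots>,(a\<^sub>n,b\<^sub>n)]\<close> becomes \<open>[a\<^sub>1,b\<^sub>1,\<dots>,a\<^sub>n,b\<^sub>n]\<close>.\<close>

definition interleave :: "('a \<times> 'a) list \<Rightarrow> 'a list" where
  "interleave ps = concat (map (\<lambda>(a, b). [a, b]) ps)"

text \<open>\<open>\<P>\<^sub>\<Gamma>(A)\<close>, as an algebra for \<open>dup_language \<Gamma>\<close>; all pairs of terms are interpreted, and the set
  \<open>\<Gamma>\<close> enters through the language only.\<close>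

definition dup_alg :: "('f, 'a) alg \<Rightarrow> ('f arity_term \<times> 'f arity_term, 'a \<times> 'a) alg" where
  "dup_alg A = \<lparr>car = car A \<times> car A,
     interp = (\<lambda>((_, t1), (_, t2)) ps. (term_op A t1 (interleave ps), term_op A t2 (interleave ps)))\<rparr>"

definition duplicates ::
  "'f language \<Rightarrow> ('f arity_term \<times> 'f arity_term) set \<Rightarrow> ('f, 'a) alg \<Rightarrow> bool" where
  "duplicates L \<Gamma> N \<longleftrightarrow>
     (\<forall>f\<in>syms L. \<forall>\<pi>\<in>{fst, snd}. \<exists>t\<in>terms (dup_language \<Gamma>) (arity L f).
        \<forall>xs\<in>tuples (arity L f) (car N).
          \<pi> (term_op (dup_alg N) t (map (\<lambda>x. (x, x)) xs)) = interp N f xs) \<and>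
     (\<exists>v\<in>terms (dup_language \<Gamma>) 2. \<forall>a\<in>car N. \<forall>b\<in>car N. \<forall>c\<in>car N. \<forall>d\<in>car N.
        term_op (dup_alg N) v [(a, b), (c, d)] = (a, d)) \<and>
     (\<exists>s\<in>terms (dup_language \<Gamma>) 1. \<forall>a\<in>car N. \<forall>b\<in>car N.
        term_op (dup_alg N) s [(a, b)] = (b, a))"

section \<open>Topological structures\<close>

text \<open>The universe is \<open>topspace (tspace X)\<close>. Throughout, \<open>G\<close> is a language of operation symbols and
  \<open>R\<close> a language of relation symbols; a relation is a set of tuples.\<close>

record ('g, 'r, 'a) tstruct =
  tops :: "'g \<Rightarrow> 'a list \<Rightarrow> 'a"
  trels :: "'r \<Rightarrow> 'a list set"
  tspace :: "'a topology"

abbreviation points :: "('g, 'r, 'a) tstruct \<Rightarrow> 'a set" where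
  "points X \<equiv> topspace (tspace X)"

definition is_tstruct :: "'g language \<Rightarrow> 'r language \<Rightarrow> ('g, 'r, 'a) tstruct \<Rightarrow> bool" where
  "is_tstruct G R X \<longleftrightarrow>
     (\<forall>g\<in>syms G. \<forall>xs\<in>tuples (arity G g) (points X). tops X g xs \<in> points X) \<and>
     (\<forall>r\<in>syms R. trels X r \<subseteq> tuples (arity R r) (points X))"

definition tstruct_power ::
  "'r language \<Rightarrow> ('g, 'r, 'a) tstruct \<Rightarrow> 'i set \<Rightarrow> ('g, 'r, 'i \<Rightarrow> 'a) tstruct" where
  "tstruct_power R M S =
     \<lparr>tops = (\<lambda>g xs. \<lambda>i\<in>S. tops M g (map (\<lambda>x. x i) xs)),
      trels = (\<lambda>r. {xs \<in> tuples (arity R r) (\<Pi>\<^sub>E i\<in>S. points M). \<forall>i\<in>S. map (\<lambda>x. x i) xs \<in> trels M r}),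
      tspace = product_topology (\<lambda>_. tspace M) S\<rparr>"

definition tstruct_square :: "('g, 'r, 'a) tstruct \<Rightarrow> ('g, 'r, 'a \<times> 'a) tstruct" where
  "tstruct_square M =
     \<lparr>tops = (\<lambda>g ps. (tops M g (map fst ps), tops M g (map snd ps))),
      trels = (\<lambda>r. {ps. map fst ps \<in> trels M r \<and> map snd ps \<in> trels M r}),
      tspace = prod_topology (tspace M) (tspace M)\<rparr>"

definition closed_substructure :: "'g language \<Rightarrow> ('g, 'r, 'a) tstruct \<Rightarrow> 'a set \<Rightarrow> bool" where
  "closed_substructure G X U \<longleftrightarrow> closedin (tspace X) U \<and>
     (\<forall>g\<in>syms G. \<forall>xs\<in>tuples (arity G g) U. tops X g xs \<in> U)"

definition substruct :: "('g, 'r, 'a) tstruct \<Rightarrow> 'a set \<Rightarrow> ('g, 'r, 'a) tstruct" where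
  "substruct X U = \<lparr>tops = tops X, trels = (\<lambda>r. trels X r \<inter> lists U),
                    tspace = subtopology (tspace X) U\<rparr>"

definition tmor ::
  "'g language \<Rightarrow> 'r language \<Rightarrow> ('g, 'r, 'a) tstruct \<Rightarrow> ('g, 'r, 'b) tstruct \<Rightarrow> ('a \<Rightarrow> 'b) set" where
  "tmor G R X Y = {\<phi> \<in> extensional (points X). continuous_map (tspace X) (tspace Y) \<phi> \<and>
     (\<forall>g\<in>syms G. \<forall>xs\<in>tuples (arity G g) (points X). \<phi> (tops X g xs) = tops Y g (map \<phi> xs)) \<and>
     (\<forall>r\<in>syms R. \<forall>xs\<in>trels X r. map \<phi> xs \<in> trels Y r)}"

definition tembedding ::
  "'g language \<Rightarrow> 'r language \<Rightarrow> ('g, 'r, 'a) tstruct \<Rightarrow> ('g, 'r, 'b) tstruct \<Rightarrow> ('a \<Rightarrow> 'b) \<Rightarrow> bool" where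
  "tembedding G R X Y \<phi> \<longleftrightarrow> \<phi> \<in> tmor G R X Y \<and> embedding_map (tspace X) (tspace Y) \<phi> \<and>
     (\<forall>r\<in>syms R. \<forall>xs\<in>tuples (arity R r) (points X). map \<phi> xs \<in> trels Y r \<longrightarrow> xs \<in> trels X r)"

definition tiso ::
  "'g language \<Rightarrow> 'r language \<Rightarrow> ('g, 'r, 'a) tstruct \<Rightarrow> ('g, 'r, 'b) tstruct \<Rightarrow> bool" where
  "tiso G R X Y \<longleftrightarrow> (\<exists>\<phi>. tembedding G R X Y \<phi> \<and> \<phi> ` points X = points Y)"

text \<open>The members of \<open>\<bbbI>\<bbbS>\<^sub>c\<bbbP>\<^sup>+(M)\<close> whose universe is a subset of the type \<open>'d\<close>; for the type of
  the index set see \<open>IScP_arbitrary_index\<close>. A closed substructure may be empty, which by closure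
  under the operations happens only in the absence of nullary operations. The morphisms \<open>tmor G R\<close>
  do not depend on \<open>M\<close>, so the category is determined by this class of objects.\<close>

definition IScP ::
  "'g language \<Rightarrow> 'r language \<Rightarrow> ('g, 'r, 'm) tstruct \<Rightarrow> ('g, 'r, 'd) tstruct set" where
  "IScP G R M = {X. is_tstruct G R X \<and>
     (\<exists>(S :: ('d \<Rightarrow> 'm) set) U. S \<noteq> {} \<and> closed_substructure G (tstruct_power R M S) U \<and>
        tiso G R X (substruct (tstruct_power R M S) U))}"

section \<open>Natural dualities\<close>

text \<open>An \<open>n\<close>-tuple of elements of \<open>M\<close>, seen as a list, corresponds to an element \<open>x\<close> of the power of
  \<open>M\<close> with index set \<open>{..<n}\<close>.\<close>

abbreviation tuple_of :: "nat \<Rightarrow> (nat \<Rightarrow> 'a) \<Rightarrow> 'a list" where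
  "tuple_of n x \<equiv> map x [0..<n]"

definition compact_topological_algebra ::
  "'f language \<Rightarrow> ('f, 'm) alg \<Rightarrow> 'm topology \<Rightarrow> bool" where
  "compact_topological_algebra L M T \<longleftrightarrow>
     is_alg L M \<and> topspace T = car M \<and> compact_space T \<and> Hausdorff_space T \<and>
     (\<forall>f\<in>syms L. continuous_map (product_topology (\<lambda>_. T) {..<arity L f}) T
        (\<lambda>x. interp M f (tuple_of (arity L f) x)))"

text \<open>A finite Hausdorff space is discrete, so the convention for finite algebras is implied.\<close>

definition alter_ego ::
  "'f language \<Rightarrow> ('f, 'm) alg \<Rightarrow> 'g language \<Rightarrow> 'r language \<Rightarrow> ('g, 'r, 'm) tstruct \<Rightarrow> bool" where
  "alter_ego L M G R Mt \<longleftrightarrow>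
     compact_topological_algebra L M (tspace Mt) \<and>
     (\<forall>g\<in>syms G. let n = arity G g in
        if n = 0 then subuniverse L M {tops Mt g []}
        else continuous_map (product_topology (\<lambda>_. tspace Mt) {..<n}) (tspace Mt)
               (\<lambda>x. tops Mt g (tuple_of n x)) \<and>
             restrict (\<lambda>x. tops Mt g (tuple_of n x)) (\<Pi>\<^sub>E i\<in>{..<n}. car M)
               \<in> alg_hom L (alg_power M {..<n}) M) \<and>
     (\<forall>r\<in>syms R. let n = arity R r; U = {x \<in> \<Pi>\<^sub>E i\<in>{..<n}. car M. tuple_of n x \<in> trels Mt r} in
        n \<ge> 1 \<and> trels Mt r \<subseteq> tuples n (car M) \<and>
        subuniverse L (alg_power M {..<n}) U \<and>
        closedin (product_topology (\<lambda>_. tspace Mt) {..<n}) U)"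

definition functor_D ::
  "'f language \<Rightarrow> ('f, 'm) alg \<Rightarrow> 'r language \<Rightarrow> ('g, 'r, 'm) tstruct \<Rightarrow>
   ('f, 'c) alg \<Rightarrow> ('g, 'r, 'c \<Rightarrow> 'm) tstruct" where
  "functor_D L M R Mt A = substruct (tstruct_power R Mt (car A)) (alg_hom L A M)"

definition functor_E ::
  "('f, 'm) alg \<Rightarrow> 'g language \<Rightarrow> 'r language \<Rightarrow> ('g, 'r, 'm) tstruct \<Rightarrow>
   ('g, 'r, 'd) tstruct \<Rightarrow> ('f, 'd \<Rightarrow> 'm) alg" where
  "functor_E M G R Mt X = subalg (alg_power M (points X)) (tmor G R X Mt)"

text \<open>The evaluation maps \<open>e\<^sub>A\<close> and \<open>\<epsilon>\<^sub>X\<close>.\<close>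

definition eval_alg ::
  "'f language \<Rightarrow> ('f, 'm) alg \<Rightarrow> ('f, 'c) alg \<Rightarrow> 'c \<Rightarrow> ('c \<Rightarrow> 'm) \<Rightarrow> 'm" where
  "eval_alg L M A a = (\<lambda>x\<in>alg_hom L A M. x a)"

definition eval_struct ::
  "'g language \<Rightarrow> 'r language \<Rightarrow> ('g, 'r, 'm) tstruct \<Rightarrow>
   ('g, 'r, 'd) tstruct \<Rightarrow> 'd \<Rightarrow> ('d \<Rightarrow> 'm) \<Rightarrow> 'm" where
  "eval_struct G R Mt X x = (\<lambda>\<alpha>\<in>tmor G R X Mt. \<alpha> x)"

text \<open>HOL has no quantification over types inside a formula, so the notions below take as type
  arguments a type \<open>'c\<close> for the algebras and a type \<open>'d\<close> for the structures under consideration.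
  The notion for all algebras and all structures is the conjunction over all such types.\<close>

definition yields_duality ::
  "'c itself \<Rightarrow> 'f language \<Rightarrow> ('f, 'm) alg \<Rightarrow>
   'g language \<Rightarrow> 'r language \<Rightarrow> ('g, 'r, 'm) tstruct \<Rightarrow> bool" where
  "yields_duality _ L M G R Mt \<longleftrightarrow>
     (\<forall>A :: ('f, 'c) alg \<in> ISP L M.
        eval_alg L M A ` car A = car (functor_E M G R Mt (functor_D L M R Mt A)))"

definition yields_full_duality ::
  "'c itself \<Rightarrow> 'd itself \<Rightarrow> 'f language \<Rightarrow> ('f, 'm) alg \<Rightarrow>
   'g language \<Rightarrow> 'r language \<Rightarrow> ('g, 'r, 'm) tstruct \<Rightarrow> bool" where
  "yields_full_duality C _ L M G R Mt \<longleftrightarrow> yields_duality C L M G R Mt \<and>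
     (\<forall>X :: ('g, 'r, 'd) tstruct \<in> IScP G R Mt.
        eval_struct G R Mt X ` points X = points (functor_D L M R Mt (functor_E M G R Mt X)))"

text \<open>Both objects of an embedding may be taken in the same type \<open>'d\<close>, since the domain is isomorphic
  to its image.\<close>

definition injective_in_IScP ::
  "'d itself \<Rightarrow> 'g language \<Rightarrow> 'r language \<Rightarrow> ('g, 'r, 'm) tstruct \<Rightarrow> bool" where
  "injective_in_IScP _ G R Mt \<longleftrightarrow>
     (\<forall>X :: ('g, 'r, 'd) tstruct \<in> IScP G R Mt. \<forall>Y :: ('g, 'r, 'd) tstruct \<in> IScP G R Mt.
        \<forall>\<phi> \<alpha>. tembedding G R X Y \<phi> \<and> \<alpha> \<in> tmor G R X Mt \<longrightarrow>
          (\<exists>\<beta>\<in>tmor G R Y Mt. \<forall>x\<in>points X. \<beta> (\<phi> x) = \<alpha> x))"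

definition yields_strong_duality ::
  "'c itself \<Rightarrow> 'd itself \<Rightarrow> 'f language \<Rightarrow> ('f, 'm) alg \<Rightarrow>
   'g language \<Rightarrow> 'r language \<Rightarrow> ('g, 'r, 'm) tstruct \<Rightarrow> bool" where
  "yields_strong_duality C D L M G R Mt \<longleftrightarrow>
     yields_full_duality C D L M G R Mt \<and> injective_in_IScP D G R Mt"

section \<open>Independence of the type of the index set\<close>

lemma alg_homD:
  assumes "h \<in> alg_hom L A B"
  shows "h \<in> car A \<rightarrow>\<^sub>E car B"
    and "\<And>f xs. f \<in> syms L \<Longrightarrow> xs \<in> tuples (arity L f) (car A) \<Longrightarrow>
           h (interp A f xs) = interp B f (map h xs)"
  using assms by (auto simp: alg_hom_def)

lemma tuples_map: "xs \<in> tuples n A \<Longrightarrow> (\<And>x. x \<in> A \<Longrightarrow> h x \<in> B) \<Longrightarrow> map h xs \<in> tuples n B"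
  by (auto simp: tuples_def)

lemma ISP_arbitrary_index:
  fixes A :: "('f, 'c) alg" and M :: "('f, 'm) alg" and S :: "'i set"
  assumes A: "is_alg L A" and U: "subuniverse L (alg_power M S) U"
    and iso: "alg_iso L A (subalg (alg_power M S) U)"
  shows "A \<in> ISP L M"
proof -
  obtain h where h: "h \<in> alg_hom L A (subalg (alg_power M S) U)" and bij: "bij_betw h (car A) U"
    using iso by (auto simp: alg_iso_def subalg_def)
  define c where "c = (\<lambda>i a. h a i)"
  define k where "k = (\<lambda>a\<in>car A. \<lambda>u\<in>c ` S. u a)"
  have hU: "h a \<in> U" if "a \<in> car A" for a
    using bij that by (auto simp: bij_betw_def)
  have US: "U \<subseteq> (\<Pi>\<^sub>E i\<in>S. car M)"
    using U by (auto simp: subuniverse_def alg_power_def)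
  have kval: "k a (c i) = h a i" if "a \<in> car A" "i \<in> S" for a i
    using that by (auto simp: k_def c_def)
  have kcar: "k a \<in> (\<Pi>\<^sub>E i\<in>c ` S. car M)" if "a \<in> car A" for a
    using that hU[OF that] US by (fastforce simp: k_def c_def PiE_iff)
  have inj: "inj_on k (car A)"
  proof (rule inj_onI)
    fix a b assume ab: "a \<in> car A" "b \<in> car A" "k a = k b"
    have "h a i = h b i" if "i \<in> S" for i
      using kval[OF ab(1) that] kval[OF ab(2) that] ab(3) by simp
    then have "h a = h b"
      using hU[OF ab(1)] hU[OF ab(2)] US by (intro PiE_ext[of _ S "\<lambda>_. car M"]) auto
    then show "a = b" using bij ab by (auto simp: bij_betw_def inj_on_def)
  qed
  have khom: "k (interp A f xs) = interp (alg_power M (c ` S)) f (map k xs)"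
    if f: "f \<in> syms L" and xs: "xs \<in> tuples (arity L f) (car A)" for f xs
  proof -
    have cl: "interp A f xs \<in> car A" using A f xs by (auto simp: is_alg_def)
    have "k (interp A f xs) (c i) = interp M f (map (\<lambda>x. x (c i)) (map k xs))" if "i \<in> S" for i
    proof -
      have "k (interp A f xs) (c i) = h (interp A f xs) i" using kval cl that by simp
      also have "\<dots> = interp M f (map (\<lambda>x. x i) (map h xs))"
        using alg_homD(2)[OF h f xs] that by (simp add: subalg_def alg_power_def)
      also have "map (\<lambda>x. x i) (map h xs) = map (\<lambda>x. x (c i)) (map k xs)"
        using xs kval that by (auto simp: tuples_def)
      finally show ?thesis .
    qed
    then show ?thesis
      using cl by (intro ext) (auto simp: alg_power_def k_def)
  qed
  have sub: "subuniverse L (alg_power M (c ` S)) (k ` car A)"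
    unfolding subuniverse_def
  proof (intro conjI ballI)
    show "k ` car A \<noteq> {}" using A by (auto simp: is_alg_def)
    show "k ` car A \<subseteq> car (alg_power M (c ` S))" using kcar by (auto simp: alg_power_def)
    fix f ys assume f: "f \<in> syms L" and ys: "ys \<in> tuples (arity L f) (k ` car A)"
    then have "ys \<in> lists (k ` car A)" by (auto simp: tuples_def)
    then obtain xs where xs: "xs \<in> lists (car A)" "ys = map k xs"
      by (auto simp: lists_image)
    then have "xs \<in> tuples (arity L f) (car A)" using ys by (auto simp: tuples_def)
    then show "interp (alg_power M (c ` S)) f ys \<in> k ` car A"
      using khom[OF f] A f xs(2) by (auto simp: is_alg_def intro!: rev_image_eqI)
  qed
  have "k \<in> alg_hom L A (subalg (alg_power M (c ` S)) (k ` car A))"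
    using khom by (auto simp: alg_hom_def subalg_def k_def)
  moreover have "bij_betw k (car A) (k ` car A)" using inj by (simp add: bij_betw_def)
  ultimately have "alg_iso L A (subalg (alg_power M (c ` S)) (k ` car A))"
    by (auto simp: alg_iso_def subalg_def)
  then show ?thesis using A sub unfolding ISP_def by blast
qed

lemma IScP_arbitrary_index:
  fixes X :: "('g, 'r, 'd) tstruct" and M :: "('g, 'r, 'm) tstruct" and S :: "'i set"
  assumes X: "is_tstruct G R X" and S: "S \<noteq> {}"
    and U: "closed_substructure G (tstruct_power R M S) U"
    and iso: "tiso G R X (substruct (tstruct_power R M S) U)"
  shows "X \<in> IScP G R M"
proof -
  define P where "P = product_topology (\<lambda>_::'i. tspace M) S"
  obtain h where h: "tembedding G R X (substruct (tstruct_power R M S) U) h"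
    and img: "h ` points X = points (substruct (tstruct_power R M S) U)"
    using iso by (auto simp: tiso_def)
  have clU: "closedin P U" using U by (auto simp: closed_substructure_def P_def tstruct_power_def)
  then have US: "U \<subseteq> (\<Pi>\<^sub>E i\<in>S. points M)" using closedin_subset[OF clU] by (simp add: P_def)
  have imgU: "h ` points X = U"
    using img US by (auto simp: substruct_def tstruct_power_def)
  have hm: "homeomorphic_map (tspace X) (subtopology P U) h"
    using h imgU by (simp add: tembedding_def embedding_map_def substruct_def tstruct_power_def
        P_def subtopology_subtopology)
  then obtain j where j: "homeomorphic_maps (tspace X) (subtopology P U) h j"
    by (auto simp: homeomorphic_map_maps)
  define c where "c = (\<lambda>i x. h x i)"
  define P' where "P' = product_topology (\<lambda>_::'d \<Rightarrow> 'm. tspace M) (c ` S)"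
  define k where "k = (\<lambda>x\<in>points X. \<lambda>u\<in>c ` S. u x)"
  define \<rho> where "\<rho> = (\<lambda>y :: ('d \<Rightarrow> 'm) \<Rightarrow> 'm. \<lambda>i\<in>S. y (c i))"
  have hU: "h x \<in> U" if "x \<in> points X" for x using imgU that by auto
  have kval: "k x (c i) = h x i" if "x \<in> points X" "i \<in> S" for x i
    using that by (auto simp: k_def c_def)
  have rho_k: "\<rho> (k x) = h x" if "x \<in> points X" for x
  proof (rule ext)
    fix i
    show "\<rho> (k x) i = h x i"
    proof (cases "i \<in> S")
      case True
      then show ?thesis using kval[OF that] by (simp add: \<rho>_def)
    next
      case False
      moreover have "h x \<in> extensional S" using hU[OF that] US by (auto simp: PiE_def)
      ultimately show ?thesis by (simp add: \<rho>_def extensional_def)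
    qed
  qed
  have cont_h: "continuous_map (tspace X) P h"
    using j by (auto simp: homeomorphic_maps_def continuous_map_in_subtopology)
  have cont_c: "continuous_map (tspace X) (tspace M) (c i)" if "i \<in> S" for i
    using cont_h that by (auto simp: P_def c_def continuous_map_componentwise)
  have cont_k: "continuous_map (tspace X) P' k"
    unfolding P'_def continuous_map_componentwise
  proof (intro conjI ballI)
    show "k ` points X \<subseteq> extensional (c ` S)" by (auto simp: k_def)
    fix u assume u: "u \<in> c ` S"
    show "continuous_map (tspace X) (tspace M) (\<lambda>x. k x u)"
      by (rule continuous_map_eq[of _ _ u]) (use u cont_c in \<open>auto simp: k_def\<close>)
  qed
  have cont_rho: "continuous_map P' P \<rho>"
    unfolding P_def P'_def continuous_map_componentwise
  proof (intro conjI ballI)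
    show "\<rho> ` topspace (product_topology (\<lambda>_. tspace M) (c ` S)) \<subseteq> extensional S"
      by (auto simp: \<rho>_def)
    fix i assume i: "i \<in> S"
    then have "continuous_map (product_topology (\<lambda>_. tspace M) (c ` S)) (tspace M) (\<lambda>y. y (c i))"
      by (intro continuous_map_product_projection) auto
    then show "continuous_map (product_topology (\<lambda>_. tspace M) (c ` S)) (tspace M) (\<lambda>y. \<rho> y i)"
      using i by (simp add: \<rho>_def)
  qed
  have top': "topspace P' = (\<Pi>\<^sub>E u\<in>c ` S. points M)" by (simp add: P'_def)
  have kP: "k x \<in> topspace P'" if "x \<in> points X" for x
    using continuous_map_image_subset_topspace[OF cont_k] that by blast
  have imgk: "k ` points X = {y \<in> topspace P'. \<rho> y \<in> U}"
  proof
    show "k ` points X \<subseteq> {y \<in> topspace P'. \<rho> y \<in> U}" using kP rho_k hU by auto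
    show "{y \<in> topspace P'. \<rho> y \<in> U} \<subseteq> k ` points X"
    proof clarify
      fix y assume y: "y \<in> topspace P'" "\<rho> y \<in> U"
      then obtain x where x: "x \<in> points X" "\<rho> y = h x" using imgU by auto
      have "y (c i) = k x (c i)" if "i \<in> S" for i
        using fun_cong[OF x(2), of i] kval[OF x(1) that] that by (simp add: \<rho>_def)
      then have "y = k x"
        using y(1) kP[OF x(1)] unfolding top'
        by (intro PiE_ext[of _ "c ` S" "\<lambda>_. points M"]) auto
      then show "y \<in> k ` points X" using x(1) by blast
    qed
  qed
  have clk: "closedin P' (k ` points X)"
    unfolding imgk by (rule closedin_continuous_map_preimage[OF cont_rho clU])
  have cont_rho_U: "continuous_map (subtopology P' (k ` points X)) (subtopology P U) \<rho>"
    using cont_rho imgk by (auto simp: continuous_map_in_subtopology continuous_map_from_subtopology)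
  have "homeomorphic_maps (tspace X) (subtopology P' (k ` points X)) k (j \<circ> \<rho>)"
    unfolding homeomorphic_maps_def
  proof (intro conjI ballI)
    show "continuous_map (tspace X) (subtopology P' (k ` points X)) k"
      using cont_k by (auto simp: continuous_map_in_subtopology)
    show "continuous_map (subtopology P' (k ` points X)) (tspace X) (j \<circ> \<rho>)"
      using cont_rho_U j by (auto simp: homeomorphic_maps_def intro: continuous_map_compose)
    show jk: "(j \<circ> \<rho>) (k x) = x" if "x \<in> points X" for x
      using rho_k j that by (auto simp: homeomorphic_maps_def)
    show "k ((j \<circ> \<rho>) y) = y" if "y \<in> topspace (subtopology P' (k ` points X))" for y
      using that jk by auto
  qed
  then have emb: "embedding_map (tspace X) P' k"
    by (auto simp: embedding_map_def homeomorphic_map_maps)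
  have kops: "k (tops X g xs) = tops (tstruct_power R M (c ` S)) g (map k xs)"
    if g: "g \<in> syms G" and xs: "xs \<in> tuples (arity G g) (points X)" for g xs
  proof -
    have cl: "tops X g xs \<in> points X" using X g xs by (auto simp: is_tstruct_def)
    have "k (tops X g xs) (c i) = tops M g (map (\<lambda>x. x (c i)) (map k xs))" if "i \<in> S" for i
    proof -
      have "k (tops X g xs) (c i) = h (tops X g xs) i" using kval cl that by simp
      also have "\<dots> = tops M g (map (\<lambda>x. x i) (map h xs))"
        using h g xs that by (simp add: tembedding_def tmor_def substruct_def tstruct_power_def)
      also have "map (\<lambda>x. x i) (map h xs) = map (\<lambda>x. x (c i)) (map k xs)"
        using xs kval that by (auto simp: tuples_def)
      finally show ?thesis .
    qed
    then show ?thesis using cl by (intro ext) (auto simp: tstruct_power_def k_def)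
  qed
  have krel: "map k xs \<in> trels (tstruct_power R M (c ` S)) r \<longleftrightarrow> xs \<in> trels X r"
    if r: "r \<in> syms R" and xs: "xs \<in> tuples (arity R r) (points X)" for r xs
  proof -
    have coord: "map (\<lambda>x. x (c i)) (map k xs) = map (\<lambda>x. x i) (map h xs)" if "i \<in> S" for i
      using xs kval that by (auto simp: tuples_def)
    have tk: "map k xs \<in> tuples (arity R r) (\<Pi>\<^sub>E u\<in>c ` S. points M)"
      using tuples_map[OF xs] kP top' by auto
    have th: "map h xs \<in> tuples (arity R r) (\<Pi>\<^sub>E i\<in>S. points M)"
      by (rule tuples_map[OF xs]) (use hU US in blast)
    have lh: "map h xs \<in> lists U"
      using xs hU by (auto simp: tuples_def in_lists_conv_set)
    have "map k xs \<in> trels (tstruct_power R M (c ` S)) r \<longleftrightarrow>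
        (\<forall>i\<in>S. map (\<lambda>x. x (c i)) (map k xs) \<in> trels M r)"
      using tk by (simp add: tstruct_power_def)
    also have "\<dots> \<longleftrightarrow> (\<forall>i\<in>S. map (\<lambda>x. x i) (map h xs) \<in> trels M r)"
      by (rule ball_cong[OF refl]) (simp only: coord)
    also have "\<dots> \<longleftrightarrow> map h xs \<in> trels (substruct (tstruct_power R M S) U) r"
      using th lh by (simp add: substruct_def tstruct_power_def)
    also have "\<dots> \<longleftrightarrow> xs \<in> trels X r"
      using h r xs by (auto simp: tembedding_def tmor_def)
    finally show ?thesis .
  qed
  let ?Y = "substruct (tstruct_power R M (c ` S)) (k ` points X)"
  have sub: "closed_substructure G (tstruct_power R M (c ` S)) (k ` points X)"
    unfolding closed_substructure_def
  proof (intro conjI ballI)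
    show "closedin (tspace (tstruct_power R M (c ` S))) (k ` points X)"
      using clk by (simp add: tstruct_power_def P'_def)
    fix g ys assume g: "g \<in> syms G" and ys: "ys \<in> tuples (arity G g) (k ` points X)"
    then have "ys \<in> lists (k ` points X)" by (auto simp: tuples_def)
    then obtain xs where xs: "xs \<in> lists (points X)" "ys = map k xs"
      by (auto simp: lists_image)
    then have "xs \<in> tuples (arity G g) (points X)" using ys by (auto simp: tuples_def)
    then show "tops (tstruct_power R M (c ` S)) g ys \<in> k ` points X"
      using kops[OF g] X g xs(2) by (auto simp: is_tstruct_def intro!: rev_image_eqI)
  qed
  have lk: "map k xs \<in> lists (k ` points X)" if "xs \<in> tuples n (points X)" for n xs
    using that by (auto simp: tuples_def in_lists_conv_set)
  have wf: "xs \<in> tuples (arity R r) (points X)" if "r \<in> syms R" "xs \<in> trels X r" for r xs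
    using X that by (auto simp: is_tstruct_def)
  have tsp: "tspace ?Y = subtopology P' (k ` points X)"
    by (simp add: substruct_def tstruct_power_def P'_def)
  have ops': "tops ?Y = tops (tstruct_power R M (c ` S))"
    by (simp add: substruct_def)
  have rels': "trels ?Y r = trels (tstruct_power R M (c ` S)) r \<inter> lists (k ` points X)" for r
    by (simp add: substruct_def)
  have kmor: "k \<in> tmor G R X ?Y"
    unfolding tmor_def mem_Collect_eq tsp ops' rels'
  proof (intro conjI ballI)
    show "k \<in> extensional (points X)" by (simp add: k_def)
    show "continuous_map (tspace X) (subtopology P' (k ` points X)) k"
      using cont_k by (auto simp: continuous_map_in_subtopology)
    show "k (tops X g xs) = tops (tstruct_power R M (c ` S)) g (map k xs)"
      if "g \<in> syms G" "xs \<in> tuples (arity G g) (points X)" for g xs using kops that .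
    show "map k xs \<in> trels (tstruct_power R M (c ` S)) r \<inter> lists (k ` points X)"
      if "r \<in> syms R" "xs \<in> trels X r" for r xs
      using krel[OF that(1) wf[OF that]] lk[OF wf[OF that]] that(2) by (intro IntI) simp_all
  qed
  have "tembedding G R X ?Y k"
    unfolding tembedding_def
  proof (intro conjI ballI impI)
    show "k \<in> tmor G R X ?Y" by (fact kmor)
    show "embedding_map (tspace X) (tspace ?Y) k"
      unfolding tsp embedding_map_in_subtopology using emb by (rule conjI) (rule subset_refl)
    show "xs \<in> trels X r" if "r \<in> syms R" "xs \<in> tuples (arity R r) (points X)"
        "map k xs \<in> trels ?Y r" for r xs
      using krel[OF that(1,2)] that(3) unfolding rels' by (blast dest: IntD1 iffD1)
  qed
  moreover have "k ` points X = points ?Y"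
    unfolding tsp topspace_subtopology using kP by blast
  ultimately have "tiso G R X ?Y" unfolding tiso_def by blast
  moreover have "c ` S \<noteq> {}" using S by simp
  ultimately show ?thesis
    unfolding IScP_def mem_Collect_eq
    using X sub by (intro conjI exI[of _ "c ` S"] exI[of _ "k ` points X"])
qed

end

theory Submission
  imports Defs
begin

text \<open>
  The duplicated algebra \<open>P(N)\<close> lives on pairs, and the terms for swapping and mixing recover the product
  decomposition inside any algebra \<open>A\<close> of \<open>\<bbbI>\<bbbS>\<bbbP>(P(N))\<close>. The fixed points of the swap term
  form the \<^emph>\<open>core\<close> of \<open>A\<close>, which corresponds to the diagonal; the terms that compute the operations of
  \<open>N\<close> on the diagonal turn it into an algebra of \<open>\<bbbI>\<bbbS>\<bbbP>(N)\<close>, and an element of \<open>A\<close> is determined by its left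
  and right parts, both in the core. Every identity needed for this holds in \<open>P(N)\<close> and passes to \<open>A\<close> because
  homomorphisms into \<open>P(N)\<close> separate the points of \<open>A\<close>. Restriction to the core and the first
  coordinate is a bijection from the homomorphisms \<open>A \<rightarrow> P(N)\<close> to the homomorphisms from the core to \<open>N\<close>, so
  \<open>A\<close> and its core have the same dual (\<open>restrict_hom\<close>, \<open>extend_hom\<close>, \<open>extend_restrict\<close>).

  On the other side, a morphism into the square of a structure is a pair of morphisms into the structure. By
  the description of \<open>\<bbbI>\<bbbS>\<^sub>c\<bbbP>\<^sup>+\<close> through separation of points and reflection of relations
  (\<open>IScP_iff_separating\<close>) the alter ego and its square have the same dual category (\<open>IScP_square\<close>),
  and injectivity passes to the square (\<open>injective_in_IScP_square\<close>).

  For the duality, a morphism from the dual of \<open>A\<close> into the square is a pair of morphisms from the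
  dual of the core, hence a pair of evaluations at elements of the core, and mixing these two
  elements gives the element of \<open>A\<close> that is sought (\<open>yields_duality_M\<close>). For fullness, a homomorphism into
  \<open>P(N)\<close> on the algebra of morphisms from \<open>X\<close> into the square is determined by its values on diagonal pairs,
  where it is an evaluation by the fullness of the given duality (\<open>eval_struct_surj_M\<close>).
\<close>

section \<open>Terms, homomorphisms and continuity\<close>

lemma term_op_closed:
  assumes closed: "\<And>f xs. f \<in> syms L \<Longrightarrow> xs \<in> tuples (arity L f) U \<Longrightarrow> interp A f xs \<in> U"
    and t: "t \<in> terms L k" and xs: "xs \<in> tuples k U"
  shows "term_op A t xs \<in> U"
  using t
proof induction
  case (1 i)
  then show ?case using xs by (auto simp: tuples_def)
next
  case (2 f ts)
  then show ?case by (auto simp: tuples_def intro!: closed)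
qed

lemma term_op_in_car:
  assumes "is_alg L A" "t \<in> terms L k" "xs \<in> tuples k (car A)"
  shows "term_op A t xs \<in> car A"
  using assms by (intro term_op_closed[where L = L]) (auto simp: is_alg_def)

lemma alg_hom_term_op:
  assumes A: "is_alg L A" and h: "h \<in> alg_hom L A B"
    and t: "t \<in> terms L k" and xs: "xs \<in> tuples k (car A)"
  shows "h (term_op A t xs) = term_op B t (map h xs)"
  using t
proof induction
  case (1 i)
  then show ?case using xs by (auto simp: tuples_def)
next
  case (2 f ts)
  have "map (\<lambda>t. term_op A t xs) ts \<in> tuples (arity L f) (car A)"
    using 2 term_op_in_car[OF A _ xs] by (auto simp: tuples_def)
  then have "h (interp A f (map (\<lambda>t. term_op A t xs) ts)) =
      interp B f (map (\<lambda>t. h (term_op A t xs)) ts)"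
    using alg_homD(2)[OF h] 2 by (simp add: o_def)
  also have "map (\<lambda>t. h (term_op A t xs)) ts = map (\<lambda>t. term_op B t (map h xs)) ts"
    using 2 by auto
  finally show ?case by simp
qed

lemma is_alg_power:
  assumes M: "is_alg L M"
  shows "is_alg L (alg_power M S)"
  unfolding is_alg_def
proof (intro conjI ballI)
  show "car (alg_power M S) \<noteq> {}"
    using M by (auto simp: is_alg_def alg_power_def PiE_eq_empty_iff)
  fix f xs assume f: "f \<in> syms L" and xs: "xs \<in> tuples (arity L f) (car (alg_power M S))"
  have "interp M f (map (\<lambda>x. x i) xs) \<in> car M" if i: "i \<in> S" for i
  proof -
    have "map (\<lambda>x. x i) xs \<in> tuples (arity L f) (car M)"
      by (rule tuples_map[OF xs]) (use i in \<open>auto simp: alg_power_def\<close>)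
    then show ?thesis using M f by (auto simp: is_alg_def)
  qed
  then show "interp (alg_power M S) f xs \<in> car (alg_power M S)"
    by (auto simp: alg_power_def)
qed

lemma projection_hom:
  assumes "is_alg L M" "i \<in> S"
  shows "(\<lambda>x\<in>car (alg_power M S). x i) \<in> alg_hom L (alg_power M S) M"
    (is "?p \<in> _")
  unfolding alg_hom_def mem_Collect_eq
proof (intro conjI ballI)
  show "?p \<in> car (alg_power M S) \<rightarrow>\<^sub>E car M"
    using assms(2) by (auto simp: alg_power_def)
  fix f xs assume f: "f \<in> syms L" and xs: "xs \<in> tuples (arity L f) (car (alg_power M S))"
  have "interp (alg_power M S) f xs \<in> car (alg_power M S)"
    using is_alg_power[OF assms(1), of S] f xs by (auto simp: is_alg_def)
  then have "?p (interp (alg_power M S) f xs) = interp M f (map (\<lambda>x. x i) xs)"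
    using assms(2) by (simp add: alg_power_def)
  also have "map (\<lambda>x. x i) xs = map ?p xs"
    using xs by (auto simp: tuples_def)
  finally show "?p (interp (alg_power M S) f xs) = interp M f (map ?p xs)" .
qed

lemma term_op_alg_power:
  assumes M: "is_alg L M" and i: "i \<in> S"
    and t: "t \<in> terms L k" and xs: "xs \<in> tuples k (car (alg_power M S))"
  shows "term_op (alg_power M S) t xs i = term_op M t (map (\<lambda>x. x i) xs)"
proof -
  let ?p = "\<lambda>x\<in>car (alg_power M S). x i"
  have "?p (term_op (alg_power M S) t xs) = term_op M t (map ?p xs)"
    by (rule alg_hom_term_op[OF is_alg_power[OF M] projection_hom[OF M i] t xs])
  moreover have "map ?p xs = map (\<lambda>x. x i) xs" using xs by (auto simp: tuples_def)
  ultimately show ?thesis using term_op_in_car[OF is_alg_power[OF M] t xs] by simp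
qed

text \<open>A finitary operation is continuous on a power of the space; it is applied to tuples whose entries
  are continuous functions of a parameter from an arbitrary space. In this form continuity passes through
  compositions, in particular through the formation of terms.\<close>

lemma continuous_map_apply_list:
  assumes F: "continuous_map (product_topology (\<lambda>_. T) {..<n}) T' (\<lambda>x. F (tuple_of n x))"
    and n: "length cs = n" and cs: "\<And>c. c \<in> set cs \<Longrightarrow> continuous_map X T c"
  shows "continuous_map X T' (\<lambda>x. F (map (\<lambda>c. c x) cs))"
proof -
  let ?j = "\<lambda>x. \<lambda>i\<in>{..<n}. (cs ! i) x"
  have "continuous_map X (product_topology (\<lambda>_. T) {..<n}) ?j"
    using cs n by (auto simp: continuous_map_componentwise)
  from continuous_map_compose[OF this F]
  have "continuous_map X T' (\<lambda>x. F (tuple_of n (?j x)))" by (simp add: o_def)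
  moreover have "tuple_of n (?j x) = map (\<lambda>c. c x) cs" for x
    using n by (auto intro: nth_equalityI)
  ultimately show ?thesis by simp
qed

lemma continuous_map_term_op:
  assumes M: "compact_topological_algebra L M T" and t: "t \<in> terms L k"
    and k: "length cs = k" and cs: "\<And>c. c \<in> set cs \<Longrightarrow> continuous_map X T c"
  shows "continuous_map X T (\<lambda>x. term_op M t (map (\<lambda>c. c x) cs))"
  using t
proof induction
  case (1 i)
  then show ?case using k cs by simp
next
  case (2 f ts)
  have f: "continuous_map (product_topology (\<lambda>_. T) {..<arity L f}) T
      (\<lambda>x. interp M f (tuple_of (arity L f) x))"
    using M 2 by (auto simp: compact_topological_algebra_def)
  have "continuous_map X T (\<lambda>x. interp M f (map (\<lambda>c. c x)
      (map (\<lambda>t x. term_op M t (map (\<lambda>c. c x) cs)) ts)))"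
    by (rule continuous_map_apply_list[OF f]) (use 2 in auto)
  then show ?case by (simp add: o_def)
qed

section \<open>The hom-functors are well defined\<close>

lemma alter_egoD:
  assumes "alter_ego L M G R Mt"
  shows "is_alg L M" "points Mt = car M" "compact_space (tspace Mt)" "Hausdorff_space (tspace Mt)"
    "compact_topological_algebra L M (tspace Mt)"
  using assms by (auto simp: alter_ego_def compact_topological_algebra_def)

lemma alter_ego_tops_closed:
  assumes ae: "alter_ego L M G R Mt" and g: "g \<in> syms G" and xs: "xs \<in> tuples (arity G g) (car M)"
  shows "tops Mt g xs \<in> car M"
proof (cases "arity G g = 0")
  case True
  then show ?thesis using ae g xs by (auto simp: alter_ego_def Let_def subuniverse_def tuples_def)
next
  case False
  let ?n = "arity G g"
  let ?x = "\<lambda>i\<in>{..<?n}. xs ! i"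
  have "restrict (\<lambda>x. tops Mt g (tuple_of ?n x)) (\<Pi>\<^sub>E i\<in>{..<?n}. car M)
      \<in> alg_hom L (alg_power M {..<?n}) M"
    using ae g False by (auto simp: alter_ego_def Let_def)
  moreover have "?x \<in> (\<Pi>\<^sub>E i\<in>{..<?n}. car M)" using xs by (auto simp: tuples_def)
  ultimately have "tops Mt g (tuple_of ?n ?x) \<in> car M"
    by (auto simp: alg_hom_def alg_power_def PiE_iff)
  moreover have "tuple_of ?n ?x = xs" using xs by (auto simp: tuples_def intro: nth_equalityI)
  ultimately show ?thesis by simp
qed

text \<open>Operations of the algebra and of the alter ego commute on a matrix with entries
  \<open>val h z\<close>: applying \<open>f\<close> to the rows and then \<open>g\<close> gives the same as applying
  \<open>g\<close> to the columns and then \<open>f\<close>. For positive arity of \<open>g\<close> this is the homomorphism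
  condition; for a constant \<open>g\<close> the left-hand side is the constant itself, and the right-hand side returns it
  because it forms a one-element subalgebra. With lists of arbitrary things
  for rows and columns, the same lemma serves homomorphisms evaluated at points of an algebra and
  morphisms evaluated at points of a structure.\<close>

lemma alter_ego_commute:
  assumes ae: "alter_ego L M G R Mt" and g: "g \<in> syms G" and f: "f \<in> syms L"
    and hs: "length hs = arity G g" and zs: "length zs = arity L f"
    and val: "\<And>h z. h \<in> set hs \<Longrightarrow> z \<in> set zs \<Longrightarrow> val h z \<in> car M"
  shows "tops Mt g (map (\<lambda>h. interp M f (map (val h) zs)) hs) =
    interp M f (map (\<lambda>z. tops Mt g (map (\<lambda>h. val h z) hs)) zs)"
proof (cases "arity G g = 0")
  case True
  then have "subuniverse L M {tops Mt g []}"
    using ae g by (auto simp: alter_ego_def Let_def)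
  moreover have "map (\<lambda>z. tops Mt g []) zs \<in> tuples (arity L f) {tops Mt g []}"
    using zs by (auto simp: tuples_def)
  ultimately have "interp M f (map (\<lambda>z. tops Mt g []) zs) = tops Mt g []"
    using f by (fastforce simp: subuniverse_def)
  then show ?thesis using True hs by simp
next
  case False
  let ?n = "arity G g"
  let ?P = "alg_power M {..<?n}"
  let ?H = "restrict (\<lambda>x. tops Mt g (tuple_of ?n x)) (\<Pi>\<^sub>E i\<in>{..<?n}. car M)"
  define row where "row = (\<lambda>z. \<lambda>i\<in>{..<?n}. val (hs ! i) z)"
  have H: "?H \<in> alg_hom L ?P M"
    using ae g False by (auto simp: alter_ego_def Let_def)
  have row: "row z \<in> (\<Pi>\<^sub>E i\<in>{..<?n}. car M)" if "z \<in> set zs" for z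
    using that hs val by (auto simp: row_def)
  then have rows: "map row zs \<in> tuples (arity L f) (car ?P)"
    using zs by (auto simp: tuples_def alg_power_def)
  have list_row: "tuple_of ?n (row z) = map (\<lambda>h. val h z) hs" for z
    using hs by (auto simp: row_def intro: nth_equalityI)
  have in_P: "interp ?P f (map row zs) \<in> car ?P"
    using is_alg_power[OF alter_egoD(1)[OF ae]] f rows by (auto simp: is_alg_def)
  have "tuple_of ?n (interp ?P f (map row zs)) = map (\<lambda>i. interp M f (map (val (hs ! i)) zs)) [0..<?n]"
    by (auto simp: alg_power_def row_def o_def)
  also have "\<dots> = map (\<lambda>h. interp M f (map (val h) zs)) hs"
    using hs by (auto intro: nth_equalityI)
  finally have "tops Mt g (map (\<lambda>h. interp M f (map (val h) zs)) hs) = ?H (interp ?P f (map row zs))"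
    using in_P by (simp add: alg_power_def)
  also have "\<dots> = interp M f (map ?H (map row zs))"
    by (rule alg_homD(2)[OF H f rows])
  also have "map ?H (map row zs) = map (\<lambda>z. tops Mt g (map (\<lambda>h. val h z) hs)) zs"
    using row list_row by auto
  finally show ?thesis .
qed

text \<open>The analogous matrix form of the fact that relations of the alter ego are subalgebras.\<close>

lemma alter_ego_rel_closed:
  assumes ae: "alter_ego L M G R Mt" and r: "r \<in> syms R" and f: "f \<in> syms L"
    and hs: "length hs = arity R r" and zs: "length zs = arity L f"
    and val: "\<And>z. z \<in> set zs \<Longrightarrow> map (\<lambda>h. val h z) hs \<in> trels Mt r"
  shows "map (\<lambda>h. interp M f (map (val h) zs)) hs \<in> trels Mt r"
proof -
  let ?n = "arity R r"
  let ?P = "alg_power M {..<?n}"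
  define U where "U = {x \<in> \<Pi>\<^sub>E i\<in>{..<?n}. car M. tuple_of ?n x \<in> trels Mt r}"
  define row where "row = (\<lambda>z. \<lambda>i\<in>{..<?n}. val (hs ! i) z)"
  have U: "subuniverse L ?P U" and tup: "trels Mt r \<subseteq> tuples ?n (car M)"
    using ae r by (auto simp: alter_ego_def Let_def U_def)
  have list_row: "tuple_of ?n (row z) = map (\<lambda>h. val h z) hs" for z
    using hs by (auto simp: row_def intro: nth_equalityI)
  have "row z \<in> U" if "z \<in> set zs" for z
  proof -
    have "map (\<lambda>h. val h z) hs \<in> tuples ?n (car M)" using val[OF that] tup by blast
    then have "row z \<in> (\<Pi>\<^sub>E i\<in>{..<?n}. car M)"
      using hs by (auto simp: row_def tuples_def)
    then show ?thesis using val[OF that] by (simp add: U_def list_row)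
  qed
  then have "map row zs \<in> tuples (arity L f) U" using zs by (auto simp: tuples_def)
  then have "interp ?P f (map row zs) \<in> U" using U f by (auto simp: subuniverse_def)
  then have "tuple_of ?n (interp ?P f (map row zs)) \<in> trels Mt r" by (simp add: U_def)
  also have "tuple_of ?n (interp ?P f (map row zs)) = map (\<lambda>i. interp M f (map (val (hs ! i)) zs)) [0..<?n]"
    by (auto simp: alg_power_def row_def o_def)
  also have "\<dots> = map (\<lambda>h. interp M f (map (val h) zs)) hs"
    using hs by (auto intro: nth_equalityI)
  finally show ?thesis .
qed

text \<open>This makes the dual of an algebra a substructure of a power: applying an operation \<open>g\<close>
  of the alter ego pointwise to homomorphisms gives a homomorphism because \<open>g\<close> commutes with every
  operation of the algebra.\<close>

lemma alg_hom_closed_under_tops: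
  assumes ae: "alter_ego L M G R Mt" and A: "is_alg L A" and g: "g \<in> syms G"
    and xs: "xs \<in> tuples (arity G g) (alg_hom L A M)"
  shows "tops (tstruct_power R Mt (car A)) g xs \<in> alg_hom L A M"
proof -
  have val: "h z \<in> car M" if "h \<in> set xs" "z \<in> car A" for h z
    using xs that by (auto simp: tuples_def alg_hom_def)
  let ?t = "\<lambda>a. tops Mt g (map (\<lambda>x. x a) xs)"
  have "?t a \<in> car M" if "a \<in> car A" for a
    using that val xs by (intro alter_ego_tops_closed[OF ae g]) (auto simp: tuples_def)
  moreover have "?t (interp A f zs) = interp M f (map (restrict ?t (car A)) zs)"
    "interp A f zs \<in> car A"
    if f: "f \<in> syms L" and zs: "zs \<in> tuples (arity L f) (car A)" for f zs
  proof -
    have "map (\<lambda>x. x (interp A f zs)) xs = map (\<lambda>x. interp M f (map x zs)) xs"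
      using xs alg_homD(2)[OF _ f zs] by (auto simp: tuples_def)
    moreover have "tops Mt g (map (\<lambda>x. interp M f (map x zs)) xs) = interp M f (map ?t zs)"
      using alter_ego_commute[OF ae g f, of xs zs "\<lambda>h z. h z"] xs zs val
      by (auto simp: tuples_def)
    moreover have "map ?t zs = map (restrict ?t (car A)) zs"
      using zs by (auto simp: tuples_def)
    ultimately show "?t (interp A f zs) = interp M f (map (restrict ?t (car A)) zs)" by metis
    show "interp A f zs \<in> car A" using A f zs by (auto simp: is_alg_def)
  qed
  ultimately show ?thesis by (auto simp: alg_hom_def tstruct_power_def)
qed

lemma points_functor_D:
  assumes "alter_ego L M G R Mt"
  shows "points (functor_D L M R Mt A) = alg_hom L A M"
  using alter_egoD(2)[OF assms]
  by (auto simp: functor_D_def substruct_def tstruct_power_def alg_hom_def)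

lemma is_tstruct_functor_D:
  assumes ae: "alter_ego L M G R Mt" and A: "is_alg L A"
  shows "is_tstruct G R (functor_D L M R Mt A)"
  using alg_hom_closed_under_tops[OF ae A]
  unfolding is_tstruct_def points_functor_D[OF ae]
  by (auto simp: functor_D_def substruct_def tstruct_power_def tuples_def)

lemma tmor_in_points: "\<phi> \<in> tmor G R X Y \<Longrightarrow> x \<in> points X \<Longrightarrow> \<phi> x \<in> points Y"
  using continuous_map_image_subset_topspace by (fastforce simp: tmor_def)

lemma eval_alg_in_tmor:
  assumes ae: "alter_ego L M G R Mt" and A: "is_alg L A" and a: "a \<in> car A"
  shows "eval_alg L M A a \<in> tmor G R (functor_D L M R Mt A) Mt"
proof -
  let ?D = "functor_D L M R Mt A"
  have pts: "points ?D = alg_hom L A M" by (rule points_functor_D[OF ae])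
  have map_eval: "map (eval_alg L M A a) xs = map (\<lambda>x. x a) xs" if "set xs \<subseteq> alg_hom L A M" for xs
    using that by (auto simp: eval_alg_def)
  have tsp: "tspace ?D = subtopology (product_topology (\<lambda>_. tspace Mt) (car A)) (alg_hom L A M)"
    by (simp add: functor_D_def substruct_def tstruct_power_def)
  have "continuous_map (tspace ?D) (tspace Mt) (\<lambda>x. x a)"
    unfolding tsp using a
    by (intro continuous_map_from_subtopology continuous_map_product_projection)
  then have cont: "continuous_map (tspace ?D) (tspace Mt) (eval_alg L M A a)"
    by (rule continuous_map_eq) (simp add: pts eval_alg_def)
  have ops: "eval_alg L M A a (tops ?D g xs) = tops Mt g (map (eval_alg L M A a) xs)"
    if g: "g \<in> syms G" and xs: "xs \<in> tuples (arity G g) (points ?D)" for g xs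
  proof -
    have "tops ?D g xs \<in> alg_hom L A M"
      using is_tstruct_functor_D[OF ae A] g xs by (auto simp: is_tstruct_def pts)
    then show ?thesis
      using xs a unfolding pts
      by (subst map_eval) (auto simp: tuples_def eval_alg_def functor_D_def substruct_def tstruct_power_def)
  qed
  have rels: "map (eval_alg L M A a) xs \<in> trels Mt r" if "xs \<in> trels ?D r" for r xs
    using that a by (subst map_eval) (auto simp: functor_D_def substruct_def tstruct_power_def)
  show ?thesis
    using cont ops rels by (auto simp: tmor_def pts) (auto simp: eval_alg_def)
qed

lemma map_restrict: "set xs \<subseteq> S \<Longrightarrow> map (restrict f S) xs = map f xs"
  by auto

text \<open>Morphisms are extensional functions, but as long as operations and relations stay inside the
  universe, the restriction to the universe can be ignored in all conditions on a morphism.\<close>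

lemma restrict_in_tmor_iff:
  assumes X: "is_tstruct G R X"
  shows "restrict c (points X) \<in> tmor G R X Y \<longleftrightarrow> continuous_map (tspace X) (tspace Y) c \<and>
    (\<forall>g\<in>syms G. \<forall>xs\<in>tuples (arity G g) (points X). c (tops X g xs) = tops Y g (map c xs)) \<and>
    (\<forall>r\<in>syms R. \<forall>xs\<in>trels X r. map c xs \<in> trels Y r)"
proof -
  let ?c = "restrict c (points X)"
  have cont: "continuous_map (tspace X) (tspace Y) ?c \<longleftrightarrow> continuous_map (tspace X) (tspace Y) c"
    by (auto elim: continuous_map_eq)
  have ops: "?c (tops X g xs) = tops Y g (map ?c xs) \<longleftrightarrow> c (tops X g xs) = tops Y g (map c xs)"
    if "g \<in> syms G" "xs \<in> tuples (arity G g) (points X)" for g xs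
  proof -
    have "tops X g xs \<in> points X" using X that by (auto simp: is_tstruct_def)
    moreover have "map ?c xs = map c xs"
      using that by (intro map_restrict) (simp add: tuples_def)
    ultimately show ?thesis by (simp only: restrict_apply')
  qed
  have rels: "map ?c xs \<in> trels Y r \<longleftrightarrow> map c xs \<in> trels Y r" if "r \<in> syms R" "xs \<in> trels X r" for r xs
  proof -
    have "xs \<in> tuples (arity R r) (points X)" using X that by (auto simp: is_tstruct_def)
    then have "map ?c xs = map c xs" by (intro map_restrict) (simp add: tuples_def)
    then show ?thesis by (simp only:)
  qed
  show ?thesis
    unfolding tmor_def mem_Collect_eq by (simp only: restrict_extensional cont ops rels simp_thms cong: ball_cong)
qed

text \<open>This makes the morphisms into the alter ego a subalgebra of a power: continuity of the algebra
  operations gives continuity of the pointwise result, and the two matrix lemmas above give preservation of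
  operations and relations.\<close>

lemma tmor_closed_under_interp:
  assumes ae: "alter_ego L M G R Mt" and X: "is_tstruct G R X" and f: "f \<in> syms L"
    and \<alpha>s: "\<alpha>s \<in> tuples (arity L f) (tmor G R X Mt)"
  shows "interp (alg_power M (points X)) f \<alpha>s \<in> tmor G R X Mt"
proof -
  let ?t = "\<lambda>x. interp M f (map (\<lambda>\<alpha>. \<alpha> x) \<alpha>s)"
  have mor: "\<alpha> \<in> tmor G R X Mt" if "\<alpha> \<in> set \<alpha>s" for \<alpha>
    using \<alpha>s that by (auto simp: tuples_def)
  have len: "length \<alpha>s = arity L f" using \<alpha>s by (auto simp: tuples_def)
  have val: "\<alpha> x \<in> car M" if "\<alpha> \<in> set \<alpha>s" "x \<in> points X" for \<alpha> x
    using tmor_in_points[OF mor] that alter_egoD(2)[OF ae] by auto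
  have f': "continuous_map (product_topology (\<lambda>_. tspace Mt) {..<arity L f}) (tspace Mt)
      (\<lambda>x. interp M f (tuple_of (arity L f) x))"
    using alter_egoD(5)[OF ae] f by (auto simp: compact_topological_algebra_def)
  have "restrict ?t (points X) \<in> tmor G R X Mt"
    unfolding restrict_in_tmor_iff[OF X]
  proof (intro conjI ballI)
    show "continuous_map (tspace X) (tspace Mt) ?t"
      by (rule continuous_map_apply_list[OF f' len]) (use mor in \<open>auto simp: tmor_def\<close>)
    show "?t (tops X g xs) = tops Mt g (map ?t xs)"
      if g: "g \<in> syms G" and xs: "xs \<in> tuples (arity G g) (points X)" for g xs
    proof -
      have "map (\<lambda>\<alpha>. \<alpha> (tops X g xs)) \<alpha>s = map (\<lambda>\<alpha>. tops Mt g (map \<alpha> xs)) \<alpha>s"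
        using mor g xs by (auto simp: tmor_def)
      moreover have "tops Mt g (map ?t xs) = interp M f (map (\<lambda>\<alpha>. tops Mt g (map \<alpha> xs)) \<alpha>s)"
        by (rule alter_ego_commute[OF ae g f, of xs \<alpha>s "\<lambda>h z. z h"])
          (use xs len val in \<open>auto simp: tuples_def\<close>)
      ultimately show ?thesis by metis
    qed
    show "map ?t xs \<in> trels Mt r" if r: "r \<in> syms R" and xs: "xs \<in> trels X r" for r xs
    proof -
      have "xs \<in> tuples (arity R r) (points X)" using X r xs by (auto simp: is_tstruct_def)
      then show ?thesis
        using alter_ego_rel_closed[OF ae r f, of xs \<alpha>s "\<lambda>h z. z h"] len mor r xs
        by (auto simp: tuples_def tmor_def)
    qed
  qed
  then show ?thesis by (simp add: alg_power_def)
qed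

lemma is_alg_functor_E:
  assumes ae: "alter_ego L M G R Mt" and X: "is_tstruct G R X" and ne: "tmor G R X Mt \<noteq> {}"
  shows "is_alg L (functor_E M G R Mt X)"
  using tmor_closed_under_interp[OF ae X] ne
  by (auto simp: is_alg_def functor_E_def subalg_def)

lemma eval_struct_in_alg_hom:
  assumes ae: "alter_ego L M G R Mt" and X: "is_tstruct G R X" and x: "x \<in> points X"
  shows "eval_struct G R Mt X x \<in> alg_hom L (functor_E M G R Mt X) M"
  unfolding alg_hom_def mem_Collect_eq
proof (intro conjI ballI)
  have car_E: "car (functor_E M G R Mt X) = tmor G R X Mt"
    by (simp add: functor_E_def subalg_def)
  show "eval_struct G R Mt X x \<in> car (functor_E M G R Mt X) \<rightarrow>\<^sub>E car M"
    using tmor_in_points[OF _ x] unfolding car_E alter_egoD(2)[OF ae, symmetric]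
    by (auto simp: eval_struct_def)
  fix f \<alpha>s assume f: "f \<in> syms L" and "\<alpha>s \<in> tuples (arity L f) (car (functor_E M G R Mt X))"
  then have \<alpha>s: "\<alpha>s \<in> tuples (arity L f) (tmor G R X Mt)" by (simp only: car_E)
  have "eval_struct G R Mt X x (interp (functor_E M G R Mt X) f \<alpha>s) = interp M f (map (\<lambda>\<alpha>. \<alpha> x) \<alpha>s)"
    using tmor_closed_under_interp[OF ae X f \<alpha>s] x
    by (simp add: eval_struct_def functor_E_def subalg_def) (simp add: alg_power_def)
  also have "map (\<lambda>\<alpha>. \<alpha> x) \<alpha>s = map (eval_struct G R Mt X x) \<alpha>s"
    using \<alpha>s by (auto simp: tuples_def eval_struct_def)
  finally show "eval_struct G R Mt X x (interp (functor_E M G R Mt X) f \<alpha>s) =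
      interp M f (map (eval_struct G R Mt X x) \<alpha>s)" .
qed


section \<open>Separation by morphisms\<close>

text \<open>Membership in \<open>\<bbbI>\<bbbS>\<bbbP>(M)\<close> expressed without embeddings: the coordinates of an
  embedding into a power separate points, and conversely, evaluation embeds \<open>A\<close> into
  the power of \<open>M\<close> indexed by all homomorphisms once these separate points. The empty
  power covers a one-element algebra without homomorphisms into \<open>M\<close>.\<close>

lemma ISP_iff_separating:
  fixes A :: "('f, 'c) alg" and M :: "('f, 'm) alg"
  shows "A \<in> ISP L M \<longleftrightarrow> is_alg L A \<and>
    (\<forall>a\<in>car A. \<forall>b\<in>car A. (\<forall>x\<in>alg_hom L A M. x a = x b) \<longrightarrow> a = b)"
proof (intro iffI conjI ballI impI)
  assume A: "A \<in> ISP L M"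
  then show alg: "is_alg L A" by (simp add: ISP_def)
  obtain S U h where US: "U \<subseteq> (\<Pi>\<^sub>E i\<in>(S :: ('c \<Rightarrow> 'm) set). car M)"
    and h: "h \<in> alg_hom L A (subalg (alg_power M S) U)" and bij: "bij_betw h (car A) U"
    using A by (auto simp: ISP_def alg_iso_def subuniverse_def alg_power_def subalg_def)
  have coord: "(\<lambda>a\<in>car A. h a i) \<in> alg_hom L A M" if i: "i \<in> S" for i
    unfolding alg_hom_def mem_Collect_eq
  proof (intro conjI ballI)
    show "(\<lambda>a\<in>car A. h a i) \<in> car A \<rightarrow>\<^sub>E car M"
      using bij US i by (fastforce simp: bij_betw_def)
    fix f xs assume f: "f \<in> syms L" and xs: "xs \<in> tuples (arity L f) (car A)"
    have "interp A f xs \<in> car A" using alg f xs by (auto simp: is_alg_def)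
    then have "(\<lambda>a\<in>car A. h a i) (interp A f xs) = interp M f (map (\<lambda>a. h a i) xs)"
      using alg_homD(2)[OF h f xs] i by (simp add: subalg_def alg_power_def o_def)
    also have "map (\<lambda>a. h a i) xs = map (\<lambda>a\<in>car A. h a i) xs"
      using xs by (auto simp: tuples_def)
    finally show "(\<lambda>a\<in>car A. h a i) (interp A f xs) = interp M f (map (\<lambda>a\<in>car A. h a i) xs)" .
  qed
  fix a b assume a: "a \<in> car A" and b: "b \<in> car A" and eq: "\<forall>x\<in>alg_hom L A M. x a = x b"
  have "h a i = h b i" if "i \<in> S" for i
    using eq[THEN bspec, OF coord[OF that]] a b by simp
  moreover have "h a \<in> (\<Pi>\<^sub>E i\<in>S. car M)" "h b \<in> (\<Pi>\<^sub>E i\<in>S. car M)"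
    using bij US a b by (auto simp: bij_betw_def)
  ultimately have "h a = h b" by (intro PiE_ext) auto
  then show "a = b" using bij a b by (auto simp: bij_betw_def inj_on_def)
next
  assume asm: "is_alg L A \<and>
    (\<forall>a\<in>car A. \<forall>b\<in>car A. (\<forall>x\<in>alg_hom L A M. x a = x b) \<longrightarrow> a = b)"
  then have alg: "is_alg L A" and sep: "\<And>a b. a \<in> car A \<Longrightarrow> b \<in> car A \<Longrightarrow>
      (\<And>x. x \<in> alg_hom L A M \<Longrightarrow> x a = x b) \<Longrightarrow> a = b"
    by auto
  let ?S = "alg_hom L A M"
  define k where "k = restrict (eval_alg L M A) (car A)"
  have k_in: "k a \<in> (\<Pi>\<^sub>E x\<in>?S. car M)" if "a \<in> car A" for a
    using that by (auto simp: k_def eval_alg_def alg_hom_def)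
  have inj: "inj_on k (car A)"
  proof (rule inj_onI)
    fix a b assume ab: "a \<in> car A" "b \<in> car A" "k a = k b"
    have "x a = x b" if "x \<in> ?S" for x
      using fun_cong[OF ab(3), of x] ab(1,2) that by (simp add: k_def eval_alg_def)
    then show "a = b" by (rule sep[OF ab(1,2)])
  qed
  have k_hom: "k (interp A f xs) = interp (alg_power M ?S) f (map k xs)" "interp A f xs \<in> car A"
    if f: "f \<in> syms L" and xs: "xs \<in> tuples (arity L f) (car A)" for f xs
  proof -
    show cl: "interp A f xs \<in> car A" using alg f xs by (auto simp: is_alg_def)
    have "x (interp A f xs) = interp M f (map (\<lambda>y. y x) (map k xs))" if "x \<in> ?S" for x
    proof -
      have "map (\<lambda>y. y x) (map k xs) = map x xs"
        using xs that by (auto simp: tuples_def k_def eval_alg_def)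
      then show ?thesis using alg_homD(2)[OF that f xs] by (simp only:)
    qed
    then show "k (interp A f xs) = interp (alg_power M ?S) f (map k xs)"
      using cl by (auto simp: k_def eval_alg_def alg_power_def)
  qed
  have "subuniverse L (alg_power M ?S) (k ` car A)"
    unfolding subuniverse_def
  proof (intro conjI ballI)
    show "k ` car A \<noteq> {}" using alg by (auto simp: is_alg_def)
    show "k ` car A \<subseteq> car (alg_power M ?S)" using k_in by (auto simp: alg_power_def)
    fix f ys assume f: "f \<in> syms L" and ys: "ys \<in> tuples (arity L f) (k ` car A)"
    then have "ys \<in> lists (k ` car A)" by (auto simp: tuples_def)
    then obtain xs where xs: "xs \<in> lists (car A)" "ys = map k xs" by (auto simp: lists_image)
    then have "xs \<in> tuples (arity L f) (car A)" using ys by (auto simp: tuples_def)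
    then show "interp (alg_power M ?S) f ys \<in> k ` car A"
      using k_hom[OF f, of xs] xs(2) by (metis imageI)
  qed
  moreover have "k \<in> alg_hom L A (subalg (alg_power M ?S) (k ` car A))"
    using k_hom by (auto simp: alg_hom_def subalg_def k_def)
  moreover have "bij_betw k (car A) (k ` car A)" using inj by (simp add: bij_betw_def)
  ultimately show "A \<in> ISP L M"
    using alg unfolding ISP_def alg_iso_def by (auto simp: subalg_def)
qed

text \<open>The topological counterpart, for a compact Hausdorff \<open>M\<close>. Given enough morphisms to
  separate points and to reflect relations, evaluation is a continuous injection from a compact space into a
  Hausdorff space, hence a closed embedding. The condition that there is a morphism at all expresses
  that the index set of the power is non-empty; without it the one-element structure in which all relations
  hold would always qualify.\<close>

lemma IScP_iff_separating:
  fixes X :: "('g, 'r, 'd) tstruct" and M :: "('g, 'r, 'm) tstruct"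
  assumes compact: "compact_space (tspace M)" and Hausdorff: "Hausdorff_space (tspace M)"
  shows "X \<in> IScP G R M \<longleftrightarrow> is_tstruct G R X \<and> compact_space (tspace X) \<and> tmor G R X M \<noteq> {} \<and>
    (\<forall>x\<in>points X. \<forall>y\<in>points X. (\<forall>\<alpha>\<in>tmor G R X M. \<alpha> x = \<alpha> y) \<longrightarrow> x = y) \<and>
    (\<forall>r\<in>syms R. \<forall>xs\<in>tuples (arity R r) (points X).
      (\<forall>\<alpha>\<in>tmor G R X M. map \<alpha> xs \<in> trels M r) \<longrightarrow> xs \<in> trels X r)"
proof (intro iffI conjI ballI impI)
  assume XI: "X \<in> IScP G R M"
  then show X: "is_tstruct G R X" by (simp add: IScP_def)
  obtain S U h where S: "(S :: ('d \<Rightarrow> 'm) set) \<noteq> {}"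
    and clU: "closedin (product_topology (\<lambda>_. tspace M) S) U"
    and h: "tembedding G R X (substruct (tstruct_power R M S) U) h"
    and img: "h ` points X = points (substruct (tstruct_power R M S) U)"
    using XI by (auto simp: IScP_def closed_substructure_def tstruct_power_def tiso_def)
  let ?P = "product_topology (\<lambda>_. tspace M) S"
  let ?Y = "substruct (tstruct_power R M S) U"
  have tsp: "tspace ?Y = subtopology ?P U" by (simp add: substruct_def tstruct_power_def)
  have US: "U \<subseteq> (\<Pi>\<^sub>E i\<in>S. points M)" using closedin_subset[OF clU] by simp
  have hU: "h x \<in> U" if "x \<in> points X" for x
    using img that by (auto simp: tsp)
  have "homeomorphic_map (tspace X) (tspace ?Y) h"
    using h img by (simp add: tembedding_def embedding_map_def)
  then have hom: "tspace X homeomorphic_space tspace ?Y" and inj: "inj_on h (points X)"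
    by (auto simp: homeomorphic_map_imp_homeomorphic_space homeomorphic_imp_injective_map)
  have "compact_space ?P" using compact by (simp add: compact_space_product_topology)
  then have "compact_space (tspace ?Y)"
    unfolding tsp using clU closedin_compact_space compact_space_subtopology by blast
  then show "compact_space (tspace X)" using homeomorphic_compact_space[OF hom] by simp
  have coord: "(\<lambda>x\<in>points X. h x i) \<in> tmor G R X M" if i: "i \<in> S" for i
    unfolding restrict_in_tmor_iff[OF X]
  proof (intro conjI ballI)
    have "continuous_map (tspace X) ?P h"
      using h by (auto simp: tembedding_def tmor_def tsp continuous_map_in_subtopology)
    then show "continuous_map (tspace X) (tspace M) (\<lambda>x. h x i)"
      using i by (auto simp: continuous_map_componentwise)
    show "h (tops X g xs) i = tops M g (map (\<lambda>x. h x i) xs)"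
      if "g \<in> syms G" "xs \<in> tuples (arity G g) (points X)" for g xs
      using h that i by (simp add: tembedding_def tmor_def substruct_def tstruct_power_def o_def)
    show "map (\<lambda>x. h x i) xs \<in> trels M r" if "r \<in> syms R" "xs \<in> trels X r" for r xs
      using h that i
      by (auto simp: tembedding_def tmor_def substruct_def tstruct_power_def o_def)
  qed
  then show "tmor G R X M \<noteq> {}" using S by blast
  show "x = y" if x: "x \<in> points X" and y: "y \<in> points X"
    and eq: "\<forall>\<alpha>\<in>tmor G R X M. \<alpha> x = \<alpha> y" for x y
  proof -
    have "h x i = h y i" if "i \<in> S" for i
      using eq[THEN bspec, OF coord[OF that]] x y by simp
    moreover have "h x \<in> (\<Pi>\<^sub>E i\<in>S. points M)" "h y \<in> (\<Pi>\<^sub>E i\<in>S. points M)"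
      using hU US x y by auto
    ultimately have "h x = h y" by (intro PiE_ext) auto
    then show "x = y" using inj x y by (auto simp: inj_on_def)
  qed
  show "xs \<in> trels X r" if r: "r \<in> syms R" and xs: "xs \<in> tuples (arity R r) (points X)"
    and rel: "\<forall>\<alpha>\<in>tmor G R X M. map \<alpha> xs \<in> trels M r" for r xs
  proof -
    have "map (\<lambda>x. h x i) xs \<in> trels M r" if "i \<in> S" for i
      using rel[THEN bspec, OF coord[OF that]] xs by (subst (asm) map_restrict) (auto simp: tuples_def)
    moreover have "map h xs \<in> tuples (arity R r) (\<Pi>\<^sub>E i\<in>S. points M)"
      by (rule tuples_map[OF xs]) (use hU US in blast)
    moreover have "map h xs \<in> lists U" using xs hU by (auto simp: tuples_def in_lists_conv_set)
    ultimately have "map h xs \<in> trels ?Y r"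
      by (simp add: substruct_def tstruct_power_def o_def)
    then show ?thesis using h r xs by (auto simp: tembedding_def)
  qed
next
  let ?H = "tmor G R X M"
  let ?P = "product_topology (\<lambda>_. tspace M) ?H"
  define k where "k = restrict (eval_struct G R M X) (points X)"
  assume asm: "is_tstruct G R X \<and> compact_space (tspace X) \<and> ?H \<noteq> {} \<and>
    (\<forall>x\<in>points X. \<forall>y\<in>points X. (\<forall>\<alpha>\<in>?H. \<alpha> x = \<alpha> y) \<longrightarrow> x = y) \<and>
    (\<forall>r\<in>syms R. \<forall>xs\<in>tuples (arity R r) (points X).
      (\<forall>\<alpha>\<in>?H. map \<alpha> xs \<in> trels M r) \<longrightarrow> xs \<in> trels X r)"
  then have X: "is_tstruct G R X" and cX: "compact_space (tspace X)" and ne: "?H \<noteq> {}"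
    and sep: "\<And>x y. x \<in> points X \<Longrightarrow> y \<in> points X \<Longrightarrow> (\<And>\<alpha>. \<alpha> \<in> ?H \<Longrightarrow> \<alpha> x = \<alpha> y) \<Longrightarrow> x = y"
    and reflect: "\<And>r xs. r \<in> syms R \<Longrightarrow> xs \<in> tuples (arity R r) (points X) \<Longrightarrow>
      (\<And>\<alpha>. \<alpha> \<in> ?H \<Longrightarrow> map \<alpha> xs \<in> trels M r) \<Longrightarrow> xs \<in> trels X r"
    by auto
  let ?Y = "substruct (tstruct_power R M ?H) (k ` points X)"
  have kval: "k x \<alpha> = \<alpha> x" if "x \<in> points X" "\<alpha> \<in> ?H" for x \<alpha>
    using that by (simp add: k_def eval_struct_def)
  have map_k: "map (\<lambda>y. y \<alpha>) (map k xs) = map \<alpha> xs" if "set xs \<subseteq> points X" "\<alpha> \<in> ?H" for xs \<alpha>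
    using that kval by auto
  have k_in: "k x \<in> (\<Pi>\<^sub>E \<alpha>\<in>?H. points M)" if "x \<in> points X" for x
    using that by (auto simp: k_def eval_struct_def tmor_in_points)
  have "continuous_map (tspace X) ?P (\<lambda>x. \<lambda>\<alpha>\<in>?H. \<alpha> x)"
    by (auto simp: continuous_map_componentwise tmor_def)
  then have cont: "continuous_map (tspace X) ?P k"
    by (rule continuous_map_eq) (simp add: k_def eval_struct_def)
  have HP: "Hausdorff_space ?P" using Hausdorff by (simp add: Hausdorff_space_product_topology)
  \<comment> \<open>Compactness against Hausdorffness: the image is closed and the inverse is continuous.\<close>
  have closed: "closed_map (tspace X) ?P k"
    by (rule continuous_imp_closed_map[OF cont cX HP])
  have "inj_on k (points X)"
  proof (rule inj_onI)
    fix x y assume xy: "x \<in> points X" "y \<in> points X" "k x = k y"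
    have "\<alpha> x = \<alpha> y" if "\<alpha> \<in> ?H" for \<alpha>
      using fun_cong[OF xy(3), of \<alpha>] xy(1,2) that by (simp add: kval)
    then show "x = y" by (rule sep[OF xy(1,2)])
  qed
  then have emb: "embedding_map (tspace X) ?P k"
    using cont closed by (intro injective_closed_imp_embedding_map)
  have k_ops: "k (tops X g xs) = tops (tstruct_power R M ?H) g (map k xs)" "tops X g xs \<in> points X"
    if g: "g \<in> syms G" and xs: "xs \<in> tuples (arity G g) (points X)" for g xs
  proof -
    show cl: "tops X g xs \<in> points X" using X g xs by (auto simp: is_tstruct_def)
    have "\<alpha> (tops X g xs) = tops M g (map (\<lambda>y. y \<alpha>) (map k xs))" if "\<alpha> \<in> ?H" for \<alpha>
    proof -
      have "set xs \<subseteq> points X" using xs by (simp add: tuples_def)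
      then have "map (\<lambda>y. y \<alpha>) (map k xs) = map \<alpha> xs" using that by (rule map_k)
      moreover have "\<alpha> (tops X g xs) = tops M g (map \<alpha> xs)"
        using that g xs by (simp add: tmor_def)
      ultimately show ?thesis by (simp only:)
    qed
    then show "k (tops X g xs) = tops (tstruct_power R M ?H) g (map k xs)"
      using cl by (auto simp: k_def eval_struct_def tstruct_power_def)
  qed
  have k_rels: "map k xs \<in> trels ?Y r \<longleftrightarrow> xs \<in> trels X r"
    if r: "r \<in> syms R" and xs: "xs \<in> tuples (arity R r) (points X)" for r xs
  proof -
    have "map k xs \<in> tuples (arity R r) (\<Pi>\<^sub>E \<alpha>\<in>?H. points M)"
      by (rule tuples_map[OF xs]) (rule k_in)
    moreover have "map k xs \<in> lists (k ` points X)"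
      using xs by (auto simp: tuples_def in_lists_conv_set)
    ultimately have "map k xs \<in> trels ?Y r \<longleftrightarrow> (\<forall>\<alpha>\<in>?H. map (\<lambda>y. y \<alpha>) (map k xs) \<in> trels M r)"
      by (simp add: substruct_def tstruct_power_def)
    also have "\<dots> \<longleftrightarrow> (\<forall>\<alpha>\<in>?H. map \<alpha> xs \<in> trels M r)"
      by (rule ball_cong[OF refl]) (use xs in \<open>simp only: map_k tuples_def mem_Collect_eq\<close>)
    also have "\<dots> \<longleftrightarrow> xs \<in> trels X r"
      using reflect[OF r xs] r by (auto simp: tmor_def)
    finally show ?thesis .
  qed
  have sub: "closed_substructure G (tstruct_power R M ?H) (k ` points X)"
    unfolding closed_substructure_def
  proof (intro conjI ballI)
    show "closedin (tspace (tstruct_power R M ?H)) (k ` points X)"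
      using closed by (auto simp: closed_map_def tstruct_power_def)
    fix g ys assume g: "g \<in> syms G" and ys: "ys \<in> tuples (arity G g) (k ` points X)"
    then have "ys \<in> lists (k ` points X)" by (auto simp: tuples_def)
    then obtain xs where xs: "xs \<in> lists (points X)" "ys = map k xs" by (auto simp: lists_image)
    then have "xs \<in> tuples (arity G g) (points X)" using ys by (auto simp: tuples_def)
    then show "tops (tstruct_power R M ?H) g ys \<in> k ` points X"
      using k_ops[OF g, of xs] xs(2) by (metis imageI)
  qed
  have tsp: "tspace ?Y = subtopology ?P (k ` points X)"
    by (simp add: substruct_def tstruct_power_def)
  have tup: "xs \<in> tuples (arity R r) (points X)" if "r \<in> syms R" "xs \<in> trels X r" for r xs
    using X that by (auto simp: is_tstruct_def)
  have "k \<in> tmor G R X ?Y"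
    unfolding tmor_def[of G R X ?Y] mem_Collect_eq
  proof (intro conjI ballI)
    show "k \<in> extensional (points X)" by (simp add: k_def)
    show "continuous_map (tspace X) (tspace ?Y) k"
      unfolding tsp using cont by (auto simp: continuous_map_in_subtopology)
    show "k (tops X g xs) = tops ?Y g (map k xs)"
      if "g \<in> syms G" "xs \<in> tuples (arity G g) (points X)" for g xs
      using k_ops[OF that] by (simp add: substruct_def)
    show "map k xs \<in> trels ?Y r" if "r \<in> syms R" "xs \<in> trels X r" for r xs
      using k_rels[OF that(1) tup[OF that]] that(2) by simp
  qed
  moreover have "embedding_map (tspace X) (tspace ?Y) k"
    unfolding tsp embedding_map_in_subtopology using emb by simp
  ultimately have "tembedding G R X ?Y k"
    unfolding tembedding_def using k_rels by blast
  moreover have "k ` points X = points ?Y"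
    unfolding tsp topspace_subtopology using k_in by auto
  ultimately have "tiso G R X ?Y" unfolding tiso_def by blast
  then show "X \<in> IScP G R M"
    unfolding IScP_def mem_Collect_eq
    using X sub ne by (intro conjI exI[of _ ?H] exI[of _ "k ` points X"])
qed

section \<open>The square of a structure\<close>

lemma tspace_square [simp]: "tspace (tstruct_square M) = prod_topology (tspace M) (tspace M)"
  by (simp add: tstruct_square_def)

text \<open>The square is a product: a morphism into it is exactly a pair of morphisms into the structure.\<close>

lemma tmor_square_iff:
  assumes X: "is_tstruct G R X"
  shows "\<phi> \<in> tmor G R X (tstruct_square M) \<longleftrightarrow> \<phi> \<in> extensional (points X) \<and>
    (\<lambda>x\<in>points X. fst (\<phi> x)) \<in> tmor G R X M \<and> (\<lambda>x\<in>points X. snd (\<phi> x)) \<in> tmor G R X M"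
proof -
  have "continuous_map (tspace X) (prod_topology (tspace M) (tspace M)) \<phi> \<longleftrightarrow>
      continuous_map (tspace X) (tspace M) (\<lambda>x. fst (\<phi> x)) \<and>
      continuous_map (tspace X) (tspace M) (\<lambda>x. snd (\<phi> x))"
    by (simp add: continuous_map_pairwise o_def)
  moreover have "\<phi> (tops X g xs) = tops (tstruct_square M) g (map \<phi> xs) \<longleftrightarrow>
      fst (\<phi> (tops X g xs)) = tops M g (map (\<lambda>x. fst (\<phi> x)) xs) \<and>
      snd (\<phi> (tops X g xs)) = tops M g (map (\<lambda>x. snd (\<phi> x)) xs)" for g xs
    by (simp add: tstruct_square_def prod_eq_iff o_def)
  moreover have "map \<phi> xs \<in> trels (tstruct_square M) r \<longleftrightarrow>
      map (\<lambda>x. fst (\<phi> x)) xs \<in> trels M r \<and> map (\<lambda>x. snd (\<phi> x)) xs \<in> trels M r" for r xs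
    by (simp add: tstruct_square_def o_def)
  ultimately show ?thesis
    unfolding restrict_in_tmor_iff[OF X] unfolding tmor_def tspace_square by blast
qed

lemma tmor_pair:
  assumes X: "is_tstruct G R X" and \<beta>: "\<beta> \<in> tmor G R X M" and \<gamma>: "\<gamma> \<in> tmor G R X M"
  shows "(\<lambda>x\<in>points X. (\<beta> x, \<gamma> x)) \<in> tmor G R X (tstruct_square M)"
proof -
  have "(\<lambda>x\<in>points X. fst ((\<lambda>x\<in>points X. (\<beta> x, \<gamma> x)) x)) = \<beta>"
    "(\<lambda>x\<in>points X. snd ((\<lambda>x\<in>points X. (\<beta> x, \<gamma> x)) x)) = \<gamma>"
    using \<beta> \<gamma> by (auto simp: tmor_def extensional_def)
  then show ?thesis using \<beta> \<gamma> by (simp only: tmor_square_iff[OF X]) simp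
qed

text \<open>Both classes are described by separation, and a structure has as many
  morphisms into \<open>M\<close> as into its square for this purpose: a morphism into the square splits into its two
  coordinates, and a morphism \<open>\<beta>\<close> into \<open>M\<close> is a coordinate of \<open>(\<beta>, \<beta>)\<close>. So the
  same points are separated and the same relations reflected.\<close>

lemma IScP_square:
  assumes compact: "compact_space (tspace M)" and Hausdorff: "Hausdorff_space (tspace M)"
  shows "IScP G R (tstruct_square M) = IScP G R M"
proof (rule set_eqI)
  fix X
  have sq: "compact_space (tspace (tstruct_square M))" "Hausdorff_space (tspace (tstruct_square M))"
    using assms by (simp_all add: compact_space_prod_topology Hausdorff_space_prod_topology)
  let ?H = "tmor G R X M" and ?H2 = "tmor G R X (tstruct_square M)"
  show "X \<in> IScP G R (tstruct_square M) \<longleftrightarrow> X \<in> IScP G R M"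
  proof (cases "is_tstruct G R X")
    case X: True
    note fst_snd = tmor_square_iff[OF X, THEN iffD1]
    note pair = tmor_pair[OF X]
    have ne: "?H2 \<noteq> {} \<longleftrightarrow> ?H \<noteq> {}" using fst_snd pair by blast
    have sep: "(\<forall>\<alpha>\<in>?H2. \<alpha> x = \<alpha> y) \<longleftrightarrow> (\<forall>\<alpha>\<in>?H. \<alpha> x = \<alpha> y)"
      if "x \<in> points X" "y \<in> points X" for x y
    proof (intro iffI ballI)
      show "\<beta> x = \<beta> y" if "\<forall>\<alpha>\<in>?H2. \<alpha> x = \<alpha> y" "\<beta> \<in> ?H" for \<beta>
        using that(1)[THEN bspec, OF pair[OF that(2,2)]] \<open>x \<in> points X\<close> \<open>y \<in> points X\<close> by simp
      show "\<alpha> x = \<alpha> y" if eq: "\<forall>\<beta>\<in>?H. \<beta> x = \<beta> y" and \<alpha>: "\<alpha> \<in> ?H2" for \<alpha>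
        using eq[THEN bspec, of "\<lambda>x\<in>points X. fst (\<alpha> x)"]
          eq[THEN bspec, of "\<lambda>x\<in>points X. snd (\<alpha> x)"]
          fst_snd[OF \<alpha>] \<open>x \<in> points X\<close> \<open>y \<in> points X\<close> by (simp add: prod_eq_iff)
    qed
    have rel: "(\<forall>\<alpha>\<in>?H2. map \<alpha> xs \<in> trels (tstruct_square M) r) \<longleftrightarrow> (\<forall>\<alpha>\<in>?H. map \<alpha> xs \<in> trels M r)"
      if "xs \<in> tuples n (points X)" for xs r n
    proof (intro iffI ballI)
      have xs: "set xs \<subseteq> points X" using that by (simp add: tuples_def)
      show "map \<beta> xs \<in> trels M r"
        if "\<forall>\<alpha>\<in>?H2. map \<alpha> xs \<in> trels (tstruct_square M) r" "\<beta> \<in> ?H" for \<beta>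
        using that(1)[THEN bspec, OF pair[OF that(2,2)]]
        by (simp only: map_restrict[OF xs]) (simp add: tstruct_square_def o_def)
      show "map \<alpha> xs \<in> trels (tstruct_square M) r"
        if eq: "\<forall>\<beta>\<in>?H. map \<beta> xs \<in> trels M r" and \<alpha>: "\<alpha> \<in> ?H2" for \<alpha>
        using eq[THEN bspec, of "\<lambda>x\<in>points X. fst (\<alpha> x)"]
          eq[THEN bspec, of "\<lambda>x\<in>points X. snd (\<alpha> x)"] fst_snd[OF \<alpha>]
        by (simp only: map_restrict[OF xs]) (simp add: tstruct_square_def o_def)
    qed
    show ?thesis
      unfolding IScP_iff_separating[OF sq] IScP_iff_separating[OF assms] ne
      using sep rel by (simp cong: ball_cong)
  next
    case False
    then show ?thesis by (simp add: IScP_def)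
  qed
qed

text \<open>The coordinates of a morphism into the square are extended separately.\<close>

lemma injective_in_IScP_square:
  fixes M :: "('g, 'r, 'm) tstruct"
  assumes compact: "compact_space (tspace M)" and Hausdorff: "Hausdorff_space (tspace M)"
    and inj: "injective_in_IScP TYPE('d) G R M"
  shows "injective_in_IScP TYPE('d) G R (tstruct_square M)"
  unfolding injective_in_IScP_def IScP_square[OF compact Hausdorff]
proof (intro ballI allI impI, elim conjE)
  fix X Y :: "('g, 'r, 'd) tstruct" and \<phi> \<alpha>
  assume XY: "X \<in> IScP G R M" "Y \<in> IScP G R M" and \<phi>: "tembedding G R X Y \<phi>"
    and \<alpha>: "\<alpha> \<in> tmor G R X (tstruct_square M)"
  have X: "is_tstruct G R X" and Y: "is_tstruct G R Y" using XY by (auto simp: IScP_def)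
  have "\<exists>\<beta>\<in>tmor G R Y M. \<forall>x\<in>points X. \<beta> (\<phi> x) = \<alpha>' x" if "\<alpha>' \<in> tmor G R X M" for \<alpha>'
    using inj XY \<phi> that by (auto simp: injective_in_IScP_def)
  note extend = this
  note fst_snd = \<alpha>[unfolded tmor_square_iff[OF X]]
  obtain \<beta> where \<beta>: "\<beta> \<in> tmor G R Y M" "\<forall>x\<in>points X. \<beta> (\<phi> x) = fst (\<alpha> x)"
    using extend[OF fst_snd[THEN conjunct2, THEN conjunct1]] by auto
  obtain \<gamma> where \<gamma>: "\<gamma> \<in> tmor G R Y M" "\<forall>x\<in>points X. \<gamma> (\<phi> x) = snd (\<alpha> x)"
    using extend[OF fst_snd[THEN conjunct2, THEN conjunct2]] by auto
  have "\<phi> x \<in> points Y" if "x \<in> points X" for x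
    using \<phi> that by (auto simp: tembedding_def tmor_in_points)
  then show "\<exists>\<beta>\<in>tmor G R Y (tstruct_square M). \<forall>x\<in>points X. \<beta> (\<phi> x) = \<alpha> x"
    using tmor_pair[OF Y \<beta>(1) \<gamma>(1)] \<beta>(2) \<gamma>(2) by (intro bexI) auto
qed


section \<open>The square as an alter ego of the duplicated algebra\<close>

lemma length_interleave [simp]: "length (interleave ps) = 2 * length ps"
  by (induction ps) (auto simp: interleave_def)

lemma interleave_in_tuples: "ps \<in> tuples n (A \<times> A) \<Longrightarrow> interleave ps \<in> tuples (2 * n) A"
  by (auto simp: tuples_def) (auto simp: interleave_def)

lemma map_interleave: "map h (interleave ps) = interleave (map (map_prod h h) ps)"
  by (induction ps) (auto simp: interleave_def)

lemma car_dup_alg [simp]: "car (dup_alg A) = car A \<times> car A"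
  by (simp add: dup_alg_def)

lemma interp_dup_alg [simp]: "interp (dup_alg A) ((k1, t1), (k2, t2)) ps =
    (term_op A t1 (interleave ps), term_op A t2 (interleave ps))"
  by (simp add: dup_alg_def)

lemma syms_dup_language [simp]: "syms (dup_language \<Gamma>) = \<Gamma>"
  by (simp add: dup_language_def)

lemma dup_symbolE:
  assumes "dup_set L \<Gamma>" "\<gamma> \<in> \<Gamma>"
  obtains n t1 t2 where "\<gamma> = ((2 * n, t1), (2 * n, t2))" "arity (dup_language \<Gamma>) \<gamma> = n"
    "t1 \<in> terms L (2 * n)" "t2 \<in> terms L (2 * n)"
proof -
  obtain k1 t1 k2 t2 where \<gamma>: "\<gamma> = ((k1, t1), (k2, t2))" by (metis surj_pair)
  have "k1 = k2" "even k1" "t1 \<in> terms L k1" "t2 \<in> terms L k2"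
    using assms unfolding \<gamma> dup_set_def by auto
  then show ?thesis using that[of "k1 div 2" t1 t2] \<gamma> by (simp add: dup_language_def)
qed

lemma subuniverse_square:
  assumes \<Gamma>: "dup_set L \<Gamma>" and U: "subuniverse L A U"
  shows "subuniverse (dup_language \<Gamma>) (dup_alg A) (U \<times> U)"
  unfolding subuniverse_def
proof (intro conjI ballI)
  show "U \<times> U \<noteq> {}" "U \<times> U \<subseteq> car (dup_alg A)" using U by (auto simp: subuniverse_def)
  fix \<gamma> ps assume "\<gamma> \<in> syms (dup_language \<Gamma>)" and ps: "ps \<in> tuples (arity (dup_language \<Gamma>) \<gamma>) (U \<times> U)"
  then have "\<gamma> \<in> \<Gamma>" by simp
  then obtain n t1 t2 where \<gamma>: "\<gamma> = ((2 * n, t1), (2 * n, t2))" "arity (dup_language \<Gamma>) \<gamma> = n"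
    "t1 \<in> terms L (2 * n)" "t2 \<in> terms L (2 * n)"
    using dup_symbolE[OF \<Gamma>] by metis
  have "interleave ps \<in> tuples (2 * n) U" using interleave_in_tuples ps \<gamma>(2) by blast
  then have "term_op A t (interleave ps) \<in> U" if "t \<in> terms L (2 * n)" for t
    using that U by (intro term_op_closed[of L U A t]) (auto simp: subuniverse_def)
  then show "interp (dup_alg A) \<gamma> ps \<in> U \<times> U" using \<gamma> by simp
qed

lemma is_alg_iff_subuniverse_car: "is_alg L A \<longleftrightarrow> subuniverse L A (car A)"
  by (auto simp: is_alg_def subuniverse_def)

lemma is_alg_dup_alg: "dup_set L \<Gamma> \<Longrightarrow> is_alg L A \<Longrightarrow> is_alg (dup_language \<Gamma>) (dup_alg A)"
  using subuniverse_square[of L \<Gamma> A "car A"] by (simp add: is_alg_iff_subuniverse_car)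

text \<open>Duplication is functorial: a homomorphism acts coordinatewise, because it preserves the
  two terms of which an operation of the duplicated algebra consists.\<close>

lemma alg_hom_dup_interp:
  assumes \<Gamma>: "dup_set L \<Gamma>" and A: "is_alg L A" and h: "h \<in> alg_hom L A B"
    and \<gamma>: "\<gamma> \<in> \<Gamma>" and ps: "ps \<in> tuples (arity (dup_language \<Gamma>) \<gamma>) (car A \<times> car A)"
  shows "map_prod h h (interp (dup_alg A) \<gamma> ps) = interp (dup_alg B) \<gamma> (map (map_prod h h) ps)"
proof -
  obtain n t1 t2 where \<gamma>': "\<gamma> = ((2 * n, t1), (2 * n, t2))" "arity (dup_language \<Gamma>) \<gamma> = n"
    "t1 \<in> terms L (2 * n)" "t2 \<in> terms L (2 * n)"
    using dup_symbolE[OF \<Gamma> \<gamma>] by metis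
  have il: "interleave ps \<in> tuples (2 * n) (car A)" using interleave_in_tuples ps \<gamma>'(2) by blast
  show ?thesis
    unfolding \<gamma>'(1) using alg_hom_term_op[OF A h _ il] \<gamma>'(3,4) by (simp add: map_interleave)
qed

text \<open>The bijection from a power of a square to the square of a power. For algebras it goes from the power of
  the duplicate to the duplicate of the power and is a homomorphism by \<open>unzip_interp\<close>.\<close>

definition unzip :: "'i set \<Rightarrow> ('i \<Rightarrow> 'a \<times> 'a) \<Rightarrow> ('i \<Rightarrow> 'a) \<times> ('i \<Rightarrow> 'a)" where
  "unzip S x = (\<lambda>i\<in>S. fst (x i), \<lambda>i\<in>S. snd (x i))"

lemma unzip_in_car:
  assumes "x \<in> car (alg_power (dup_alg A) S)"
  shows "unzip S x \<in> car (dup_alg (alg_power A S))"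
proof -
  have "x i \<in> car A \<times> car A" if "i \<in> S" for i
    using assms that by (auto simp: alg_power_def)
  then show ?thesis by (simp add: unzip_def alg_power_def mem_Times_iff)
qed

lemma unzip_interp:
  assumes \<Gamma>: "dup_set L \<Gamma>" and A: "is_alg L A" and \<gamma>: "\<gamma> \<in> \<Gamma>"
    and xs: "xs \<in> tuples (arity (dup_language \<Gamma>) \<gamma>) (car (alg_power (dup_alg A) S))"
  shows "unzip S (interp (alg_power (dup_alg A) S) \<gamma> xs) =
    interp (dup_alg (alg_power A S)) \<gamma> (map (unzip S) xs)"
proof -
  obtain n t1 t2 where \<gamma>': "\<gamma> = ((2 * n, t1), (2 * n, t2))" "arity (dup_language \<Gamma>) \<gamma> = n"
    "t1 \<in> terms L (2 * n)" "t2 \<in> terms L (2 * n)"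
    using dup_symbolE[OF \<Gamma> \<gamma>] by metis
  let ?P = "alg_power A S"
  let ?il = "interleave (map (unzip S) xs)"
  have "map (unzip S) xs \<in> tuples n (car ?P \<times> car ?P)"
    by (rule tuples_map[OF xs[unfolded \<gamma>'(2)]]) (use unzip_in_car[of _ A S] in simp)
  then have il: "?il \<in> tuples (2 * n) (car ?P)" by (rule interleave_in_tuples)
  have coord: "(\<lambda>i\<in>S. term_op A t (interleave (map (\<lambda>x. x i) xs))) = term_op ?P t ?il"
    if t: "t \<in> terms L (2 * n)" for t
  proof
    fix i
    show "(\<lambda>i\<in>S. term_op A t (interleave (map (\<lambda>x. x i) xs))) i = term_op ?P t ?il i"
    proof (cases "i \<in> S")
      case True
      have "term_op ?P t ?il i = term_op A t (map (\<lambda>x. x i) ?il)"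
        by (rule term_op_alg_power[OF A True t il])
      also have "map (\<lambda>x. x i) ?il = interleave (map (\<lambda>x. x i) xs)"
        using True by (simp add: map_interleave unzip_def o_def)
      finally show ?thesis using True by simp
    next
      case False
      have "term_op ?P t ?il \<in> car ?P" by (rule term_op_in_car[OF is_alg_power[OF A] t il])
      then have "term_op ?P t ?il i = undefined"
        using False by (intro PiE_arb[of _ S "\<lambda>_. car A"]) (simp_all add: alg_power_def)
      then show ?thesis using False by simp
    qed
  qed
  have "unzip S (interp (alg_power (dup_alg A) S) \<gamma> xs) =
      (\<lambda>i\<in>S. term_op A t1 (interleave (map (\<lambda>x. x i) xs)),
       \<lambda>i\<in>S. term_op A t2 (interleave (map (\<lambda>x. x i) xs)))"
    by (simp add: \<gamma>'(1) unzip_def alg_power_def cong: restrict_cong)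
  then show ?thesis using coord \<gamma>' by simp
qed

lemma compact_topological_algebra_dup_alg:
  fixes A :: "('f, 'a) alg"
  assumes \<Gamma>: "dup_set L \<Gamma>" and A: "compact_topological_algebra L A T"
  shows "compact_topological_algebra (dup_language \<Gamma>) (dup_alg A) (prod_topology T T)"
  unfolding compact_topological_algebra_def
proof (intro conjI ballI)
  show "is_alg (dup_language \<Gamma>) (dup_alg A)"
    using is_alg_dup_alg[OF \<Gamma>, of A] A by (simp add: compact_topological_algebra_def)
  show "topspace (prod_topology T T) = car (dup_alg A)" "compact_space (prod_topology T T)"
    "Hausdorff_space (prod_topology T T)"
    using A by (simp_all add: compact_topological_algebra_def compact_space_prod_topology
        Hausdorff_space_prod_topology)
  fix \<gamma> assume "\<gamma> \<in> syms (dup_language \<Gamma>)"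
  then have "\<gamma> \<in> \<Gamma>" by simp
  then obtain n t1 t2 where \<gamma>: "\<gamma> = ((2 * n, t1), (2 * n, t2))" "arity (dup_language \<Gamma>) \<gamma> = n"
    "t1 \<in> terms L (2 * n)" "t2 \<in> terms L (2 * n)"
    using dup_symbolE[OF \<Gamma>] by metis
  \<comment> \<open>Interleaving a tuple of pairs lists the values of the \<open>2 * n\<close> coordinate functions on it.\<close>
  define cs :: "((nat \<Rightarrow> 'a \<times> 'a) \<Rightarrow> 'a) list" where "cs = concat (map (\<lambda>i. [\<lambda>x. fst (x i), \<lambda>x. snd (x i)]) [0..<n])"
  let ?P = "product_topology (\<lambda>_. prod_topology T T) {..<n}"
  have il: "interleave (tuple_of n x) = map (\<lambda>c. c x) cs" for x
    by (simp add: interleave_def cs_def map_concat o_def case_prod_beta)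
  have len: "length cs = 2 * n"
    using arg_cong[OF il, of length] by simp
  have cont: "continuous_map ?P T c" if c: "c \<in> set cs" for c
  proof -
    obtain i where i: "i < n" "c = (\<lambda>x. fst (x i)) \<or> c = (\<lambda>x. snd (x i))"
      using c by (auto simp: cs_def)
    have "continuous_map ?P (prod_topology T T) (\<lambda>x. x i)"
      using i by (intro continuous_map_product_projection) simp
    then show ?thesis using i(2) by (auto simp: continuous_map_pairwise o_def)
  qed
  have "continuous_map ?P T (\<lambda>x. term_op A t (interleave (tuple_of n x)))" if "t \<in> terms L (2 * n)" for t
    unfolding il by (rule continuous_map_term_op[OF A that len cont])
  then show "continuous_map (product_topology (\<lambda>_. prod_topology T T) {..<arity (dup_language \<Gamma>) \<gamma>})
      (prod_topology T T) (\<lambda>x. interp (dup_alg A) \<gamma> (tuple_of (arity (dup_language \<Gamma>) \<gamma>) x))"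
    unfolding \<gamma>(2) using \<gamma> by (simp add: continuous_map_pairwise o_def)
qed

lemma tuple_of_fst_snd:
  "map fst (tuple_of n x) = tuple_of n (fst (unzip {..<n} x))"
  "map snd (tuple_of n x) = tuple_of n (snd (unzip {..<n} x))"
  by (auto simp: unzip_def)

lemma continuous_map_unzip:
  "continuous_map (product_topology (\<lambda>_. prod_topology T T) S) (product_topology (\<lambda>_. T) S)
    (\<lambda>x. fst (unzip S x))" (is "continuous_map ?P ?Q _")
  "continuous_map (product_topology (\<lambda>_. prod_topology T T) S) (product_topology (\<lambda>_. T) S)
    (\<lambda>x. snd (unzip S x))"
proof -
  have "continuous_map ?P (prod_topology T T) (\<lambda>x. x i)" if "i \<in> S" for i
    using that by (intro continuous_map_product_projection)
  then have "continuous_map ?P T (\<lambda>x. fst (x i))" "continuous_map ?P T (\<lambda>x. snd (x i))"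
    if "i \<in> S" for i
    using that by (simp_all add: continuous_map_pairwise o_def)
  then show "continuous_map ?P ?Q (\<lambda>x. fst (unzip S x))" "continuous_map ?P ?Q (\<lambda>x. snd (unzip S x))"
    unfolding continuous_map_componentwise by (simp_all add: unzip_def image_subset_iff)
qed

text \<open>Everything is transported along \<open>unzip\<close>: an operation of the square is the duplicate of
  an operation of the alter ego after \<open>unzip\<close>, and a relation of the square is the preimage under \<open>unzip\<close> of
  \<open>U \<times> U\<close> for the corresponding relation \<open>U\<close>. Homomorphisms, subalgebras, continuity and
  closedness are all preserved by these constructions.\<close>

lemma alter_ego_square:
  assumes \<Gamma>: "dup_set L \<Gamma>" and ae: "alter_ego L A G R At"
  shows "alter_ego (dup_language \<Gamma>) (dup_alg A) G R (tstruct_square At)"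
  unfolding alter_ego_def Let_def
proof (intro conjI ballI)
  show "compact_topological_algebra (dup_language \<Gamma>) (dup_alg A) (tspace (tstruct_square At))"
    using compact_topological_algebra_dup_alg[OF \<Gamma> alter_egoD(5)[OF ae]] by simp
next
  note A = alter_egoD(1)[OF ae]
  fix g assume g: "g \<in> syms G"
  let ?n = "arity G g"
  let ?S = "{..<?n}"
  let ?h = "restrict (\<lambda>x. tops At g (tuple_of ?n x)) (\<Pi>\<^sub>E i\<in>?S. car A)"
  let ?h2 = "\<lambda>x. tops (tstruct_square At) g (tuple_of ?n x)"
  show "if ?n = 0 then subuniverse (dup_language \<Gamma>) (dup_alg A) {tops (tstruct_square At) g []}
    else continuous_map (product_topology (\<lambda>_. tspace (tstruct_square At)) ?S)
           (tspace (tstruct_square At)) ?h2 \<and>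
         restrict ?h2 (\<Pi>\<^sub>E i\<in>?S. car (dup_alg A))
           \<in> alg_hom (dup_language \<Gamma>) (alg_power (dup_alg A) ?S) (dup_alg A)"
  proof (cases "?n = 0")
    case True
    then have "subuniverse L A {tops At g []}" using ae g by (auto simp: alter_ego_def Let_def)
    from subuniverse_square[OF \<Gamma> this] show ?thesis using True by (simp add: tstruct_square_def)
  next
    case False
    then have cont: "continuous_map (product_topology (\<lambda>_. tspace At) ?S) (tspace At)
        (\<lambda>x. tops At g (tuple_of ?n x))"
      and h: "?h \<in> alg_hom L (alg_power A ?S) A"
      using ae g by (auto simp: alter_ego_def Let_def)
    have h2: "?h2 x = (tops At g (tuple_of ?n (fst (unzip ?S x))), tops At g (tuple_of ?n (snd (unzip ?S x))))"
      for x
      by (simp only: tuple_of_fst_snd[symmetric]) (simp add: tstruct_square_def)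
    have "continuous_map (product_topology (\<lambda>_. tspace (tstruct_square At)) ?S)
        (tspace (tstruct_square At)) ?h2"
      unfolding h2 tspace_square
      using continuous_map_compose[OF continuous_map_unzip(1) cont]
        continuous_map_compose[OF continuous_map_unzip(2) cont]
      by (simp add: continuous_map_pairwise o_def)
    moreover have "restrict ?h2 (car (alg_power (dup_alg A) ?S))
        \<in> alg_hom (dup_language \<Gamma>) (alg_power (dup_alg A) ?S) (dup_alg A)" (is "?r \<in> _")
    proof -
      have r: "?r x = map_prod ?h ?h (unzip ?S x)" if "x \<in> car (alg_power (dup_alg A) ?S)" for x
      proof -
        have "fst (unzip ?S x) \<in> (\<Pi>\<^sub>E i\<in>?S. car A)" "snd (unzip ?S x) \<in> (\<Pi>\<^sub>E i\<in>?S. car A)"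
          using unzip_in_car[OF that] by (auto simp: alg_power_def mem_Times_iff)
        then have "map_prod ?h ?h (unzip ?S x) = ?h2 x"
          unfolding h2 by (simp only: map_prod_def case_prod_beta restrict_apply')
        then show ?thesis using that by simp
      qed
      show ?thesis
        unfolding alg_hom_def mem_Collect_eq
      proof (intro conjI ballI)
        show "?r \<in> car (alg_power (dup_alg A) ?S) \<rightarrow>\<^sub>E car (dup_alg A)"
        proof (rule PiE_I)
          fix x assume x: "x \<in> car (alg_power (dup_alg A) ?S)"
          show "?r x \<in> car (dup_alg A)"
            using unzip_in_car[OF x] PiE_mem[OF alg_homD(1)[OF h]]
            unfolding r[OF x] mem_Times_iff car_dup_alg fst_map_prod snd_map_prod by blast
        qed simp
        fix \<gamma> xs assume "\<gamma> \<in> syms (dup_language \<Gamma>)"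
          and xs: "xs \<in> tuples (arity (dup_language \<Gamma>) \<gamma>) (car (alg_power (dup_alg A) ?S))"
        then have \<gamma>: "\<gamma> \<in> \<Gamma>" by simp
        have in_car: "interp (alg_power (dup_alg A) ?S) \<gamma> xs \<in> car (alg_power (dup_alg A) ?S)"
          using is_alg_power[OF is_alg_dup_alg[OF \<Gamma> A]] \<gamma> xs by (auto simp: is_alg_def)
        have us: "map (unzip ?S) xs \<in> tuples (arity (dup_language \<Gamma>) \<gamma>)
            (car (alg_power A ?S) \<times> car (alg_power A ?S))"
          by (rule tuples_map[OF xs]) (use unzip_in_car[of _ A ?S] in simp)
        have "?r (interp (alg_power (dup_alg A) ?S) \<gamma> xs) =
            interp (dup_alg A) \<gamma> (map (map_prod ?h ?h) (map (unzip ?S) xs))"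
          unfolding r[OF in_car] unzip_interp[OF \<Gamma> A \<gamma> xs]
          by (rule alg_hom_dup_interp[OF \<Gamma> is_alg_power[OF A] h \<gamma> us])
        also have "map (map_prod ?h ?h) (map (unzip ?S) xs) = map ?r xs"
          unfolding map_map map_eq_conv o_apply
          by (intro ballI r[symmetric]) (use xs in \<open>auto simp: tuples_def\<close>)
        finally show "?r (interp (alg_power (dup_alg A) ?S) \<gamma> xs) =
            interp (dup_alg A) \<gamma> (map ?r xs)" .
      qed
    qed
    moreover have "car (alg_power (dup_alg A) ?S) = (\<Pi>\<^sub>E i\<in>?S. car (dup_alg A))"
      by (simp add: alg_power_def)
    ultimately show ?thesis using False by (simp only: if_False simp_thms)
  qed
next
  note A = alter_egoD(1)[OF ae]
  fix r assume r: "r \<in> syms R"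
  let ?n = "arity R r"
  let ?S = "{..<?n}"
  define U where "U = {x \<in> \<Pi>\<^sub>E i\<in>?S. car A. tuple_of ?n x \<in> trels At r}"
  have n: "?n \<ge> 1" and tup: "trels At r \<subseteq> tuples ?n (car A)"
    and U: "subuniverse L (alg_power A ?S) U"
    and cl: "closedin (product_topology (\<lambda>_. tspace At) ?S) U"
    using ae r by (auto simp: alter_ego_def Let_def U_def)
  show "?n \<ge> 1" by (rule n)
  show "trels (tstruct_square At) r \<subseteq> tuples ?n (car (dup_alg A))"
  proof
    fix ps assume "ps \<in> trels (tstruct_square At) r"
    then have "map fst ps \<in> tuples ?n (car A)" "map snd ps \<in> tuples ?n (car A)"
      using tup by (auto simp: tstruct_square_def)
    then show "ps \<in> tuples ?n (car (dup_alg A))"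
      by (auto simp: tuples_def mem_Times_iff subset_iff)
  qed
  let ?U2 = "{x \<in> \<Pi>\<^sub>E i\<in>?S. car (dup_alg A). tuple_of ?n x \<in> trels (tstruct_square At) r}"
  have U2: "?U2 = {x \<in> car (alg_power (dup_alg A) ?S). unzip ?S x \<in> U \<times> U}"
  proof (rule Collect_cong, simp only: alg_power_def alg.simps, rule conj_cong[OF refl])
    fix x assume "x \<in> (\<Pi>\<^sub>E i\<in>?S. car (dup_alg A))"
    then have "unzip ?S x \<in> (\<Pi>\<^sub>E i\<in>?S. car A) \<times> (\<Pi>\<^sub>E i\<in>?S. car A)"
      using unzip_in_car[of x A ?S] by (simp add: alg_power_def)
    then show "tuple_of ?n x \<in> trels (tstruct_square At) r \<longleftrightarrow> unzip ?S x \<in> U \<times> U"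
      by (simp add: tstruct_square_def U_def mem_Times_iff del: map_map)
        (simp add: tuple_of_fst_snd del: map_map)
  qed
  show "subuniverse (dup_language \<Gamma>) (alg_power (dup_alg A) ?S) ?U2"
    unfolding U2 subuniverse_def
  proof (intro conjI ballI)
    \<comment> \<open>A diagonal tuple shows that the relation is non-empty.\<close>
    obtain u where u: "u \<in> U" using U by (auto simp: subuniverse_def)
    then have uP: "u \<in> (\<Pi>\<^sub>E i\<in>?S. car A)" by (simp add: U_def)
    then have "unzip ?S (\<lambda>i\<in>?S. (u i, u i)) = (u, u)"
      by (auto simp: unzip_def PiE_def extensional_def)
    moreover have "(\<lambda>i\<in>?S. (u i, u i)) \<in> car (alg_power (dup_alg A) ?S)"
      using uP by (auto simp: alg_power_def)
    ultimately show "{x \<in> car (alg_power (dup_alg A) ?S). unzip ?S x \<in> U \<times> U} \<noteq> {}"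
      using u by auto
    show "{x \<in> car (alg_power (dup_alg A) ?S). unzip ?S x \<in> U \<times> U} \<subseteq> car (alg_power (dup_alg A) ?S)"
      by blast
    fix \<gamma> xs assume "\<gamma> \<in> syms (dup_language \<Gamma>)"
      and xs: "xs \<in> tuples (arity (dup_language \<Gamma>) \<gamma>)
        {x \<in> car (alg_power (dup_alg A) ?S). unzip ?S x \<in> U \<times> U}"
    then have \<gamma>: "\<gamma> \<in> \<Gamma>" by simp
    have xs': "xs \<in> tuples (arity (dup_language \<Gamma>) \<gamma>) (car (alg_power (dup_alg A) ?S))"
      using xs by (auto simp: tuples_def)
    have "map (unzip ?S) xs \<in> tuples (arity (dup_language \<Gamma>) \<gamma>) (U \<times> U)"
      by (rule tuples_map[OF xs]) simp
    then have "interp (dup_alg (alg_power A ?S)) \<gamma> (map (unzip ?S) xs) \<in> U \<times> U"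
      using subuniverse_square[OF \<Gamma> U] \<gamma> by (simp only: subuniverse_def syms_dup_language)
    moreover have "interp (alg_power (dup_alg A) ?S) \<gamma> xs \<in> car (alg_power (dup_alg A) ?S)"
      using is_alg_power[OF is_alg_dup_alg[OF \<Gamma> A]] \<gamma> xs' by (auto simp: is_alg_def)
    ultimately show "interp (alg_power (dup_alg A) ?S) \<gamma> xs
        \<in> {x \<in> car (alg_power (dup_alg A) ?S). unzip ?S x \<in> U \<times> U}"
      using unzip_interp[OF \<Gamma> A \<gamma> xs'] by simp
  qed
  let ?P = "product_topology (\<lambda>_. prod_topology (tspace At) (tspace At)) ?S"
  have top: "topspace ?P = car (alg_power (dup_alg A) ?S)"
    using alter_egoD(2)[OF ae] by (simp add: alg_power_def)
  have U2_preimage: "?U2 = {x \<in> topspace ?P. fst (unzip ?S x) \<in> U} \<inter> {x \<in> topspace ?P. snd (unzip ?S x) \<in> U}"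
    unfolding U2 top by (auto simp: mem_Times_iff)
  show "closedin (product_topology (\<lambda>_. tspace (tstruct_square At)) ?S) ?U2"
    unfolding U2_preimage tspace_square
    by (intro closedin_Int closedin_continuous_map_preimage[OF continuous_map_unzip(1) cl]
        closedin_continuous_map_preimage[OF continuous_map_unzip(2) cl])
qed


section \<open>The algebra inside an algebra of the duplicated variety\<close>

text \<open>A choice of terms that witness the conditions on \<open>\<Gamma>\<close>. For an operation symbol
  \<open>f\<close>, the term \<open>lift f\<close> computes \<open>f\<close> on the diagonal, as far as the first coordinate is concerned; its second
  coordinate is arbitrary and will be corrected by \<open>v\<close> and \<open>s\<close>.\<close>

locale duplication =
  fixes L :: "'f language" and \<Gamma> :: "('f arity_term \<times> 'f arity_term) set" and N :: "('f, 'n) alg"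
    and v s :: "('f arity_term \<times> 'f arity_term) trm"
    and lift :: "'f \<Rightarrow> ('f arity_term \<times> 'f arity_term) trm"
  assumes alg_N: "is_alg L N" and dup_set: "dup_set L \<Gamma>"
    and v: "v \<in> terms (dup_language \<Gamma>) 2"
    and v_eq: "\<And>p q. p \<in> car N \<times> car N \<Longrightarrow> q \<in> car N \<times> car N \<Longrightarrow>
      term_op (dup_alg N) v [p, q] = (fst p, snd q)"
    and s: "s \<in> terms (dup_language \<Gamma>) 1"
    and s_eq: "\<And>p. p \<in> car N \<times> car N \<Longrightarrow> term_op (dup_alg N) s [p] = prod.swap p"
    and lift: "\<And>f. f \<in> syms L \<Longrightarrow> lift f \<in> terms (dup_language \<Gamma>) (arity L f)"
    and lift_eq: "\<And>f xs. f \<in> syms L \<Longrightarrow> xs \<in> tuples (arity L f) (car N) \<Longrightarrow>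
      fst (term_op (dup_alg N) (lift f) (map (\<lambda>x. (x, x)) xs)) = interp N f xs"
begin

abbreviation "\<Delta> \<equiv> dup_language \<Gamma>"
abbreviation "M \<equiv> dup_alg N"

text \<open>The term functions of \<open>s\<close> and \<open>v\<close> on any algebra \<open>A\<close> of the duplicated type, and two
  derived unary operations. On pairs, \<open>left\<close> and \<open>right\<close> send \<open>(p, q)\<close> to \<open>(p, p)\<close> and
  \<open>(q, q)\<close>.\<close>

definition swap where "swap A a = term_op A s [a]"
definition mix where "mix A a b = term_op A v [a, b]"
definition left where "left A a = mix A a (swap A a)"
definition right where "right A a = mix A (swap A a) a"

text \<open>The algebra of the original type inside \<open>A\<close>. If \<open>A\<close> is the duplicate of \<open>B\<close>, this is the
  diagonal copy of \<open>B\<close>: the diagonal consists of the fixed points of \<open>swap\<close>, and \<open>left\<close> replaces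
  the unknown second coordinate of \<open>lift f\<close>. As a subset of \<open>A\<close> it has elements of the same type as
  \<open>A\<close>, so a duality for the algebras of that type applies to it.\<close>

definition core :: "('f arity_term \<times> 'f arity_term, 'c) alg \<Rightarrow> ('f, 'c) alg" where
  "core A = \<lparr>car = {a \<in> car A. swap A a = a}, interp = (\<lambda>f xs. left A (term_op A (lift f) xs))\<rparr>"

lemma core_subset: "a \<in> car (core A) \<Longrightarrow> a \<in> car A"
  by (simp add: core_def)

lemma tuples_core: "xs \<in> tuples n (car (core A)) \<Longrightarrow> xs \<in> tuples n (car A)"
  by (auto simp: tuples_def core_def)

lemma swap_closed: "is_alg \<Delta> A \<Longrightarrow> a \<in> car A \<Longrightarrow> swap A a \<in> car A"
  unfolding swap_def by (rule term_op_in_car[OF _ s]) (simp_all add: tuples_def)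

lemma mix_closed: "is_alg \<Delta> A \<Longrightarrow> a \<in> car A \<Longrightarrow> b \<in> car A \<Longrightarrow> mix A a b \<in> car A"
  unfolding mix_def by (rule term_op_in_car[OF _ v]) (simp_all add: tuples_def)

lemma left_closed: "is_alg \<Delta> A \<Longrightarrow> a \<in> car A \<Longrightarrow> left A a \<in> car A"
  unfolding left_def by (intro mix_closed swap_closed)

lemma right_closed: "is_alg \<Delta> A \<Longrightarrow> a \<in> car A \<Longrightarrow> right A a \<in> car A"
  unfolding right_def by (intro mix_closed swap_closed)

lemma hom_in_square: "x \<in> alg_hom \<Delta> A M \<Longrightarrow> a \<in> car A \<Longrightarrow> x a \<in> car N \<times> car N"
  by (auto simp: alg_hom_def)

lemma hom_swap:
  assumes A: "is_alg \<Delta> A" and x: "x \<in> alg_hom \<Delta> A M" and a: "a \<in> car A"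
  shows "x (swap A a) = prod.swap (x a)"
proof -
  have "[a] \<in> tuples 1 (car A)" using a by (simp add: tuples_def)
  from alg_hom_term_op[OF A x s this] show ?thesis
    using s_eq[OF hom_in_square[OF x a]] by (simp add: swap_def)
qed

lemma hom_mix:
  assumes A: "is_alg \<Delta> A" and x: "x \<in> alg_hom \<Delta> A M" and a: "a \<in> car A" and b: "b \<in> car A"
  shows "x (mix A a b) = (fst (x a), snd (x b))"
proof -
  have "[a, b] \<in> tuples 2 (car A)" using a b by (simp add: tuples_def)
  from alg_hom_term_op[OF A x v this] show ?thesis
    using v_eq[OF hom_in_square[OF x a] hom_in_square[OF x b]] by (simp add: mix_def)
qed

lemma hom_left:
  assumes A: "is_alg \<Delta> A" and x: "x \<in> alg_hom \<Delta> A M" and a: "a \<in> car A"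
  shows "x (left A a) = (fst (x a), fst (x a))"
  unfolding left_def hom_mix[OF A x a swap_closed[OF A a]] hom_swap[OF A x a] by simp

lemma hom_right:
  assumes A: "is_alg \<Delta> A" and x: "x \<in> alg_hom \<Delta> A M" and a: "a \<in> car A"
  shows "x (right A a) = (snd (x a), snd (x a))"
  unfolding right_def hom_mix[OF A x swap_closed[OF A a] a] hom_swap[OF A x a] by simp

lemma hom_core:
  assumes A: "is_alg \<Delta> A" and x: "x \<in> alg_hom \<Delta> A M" and a: "a \<in> car (core A)"
  shows "snd (x a) = fst (x a)"
proof -
  have "swap A a = a" "a \<in> car A" using a by (simp_all add: core_def)
  then have "x a = prod.swap (x a)" using hom_swap[OF A x, of a] by simp
  from arg_cong[OF this, of snd] show ?thesis by simp
qed

text \<open>Homomorphisms into \<open>M\<close> see the operations of the core as the operations of \<open>N\<close> on the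
  diagonal, which makes the core an algebra of the original type.\<close>

lemma hom_core_interp:
  assumes A: "is_alg \<Delta> A" and x: "x \<in> alg_hom \<Delta> A M"
    and f: "f \<in> syms L" and xs: "xs \<in> tuples (arity L f) (car (core A))"
  shows "x (interp (core A) f xs) =
    (interp N f (map (\<lambda>a. fst (x a)) xs), interp N f (map (\<lambda>a. fst (x a)) xs))"
proof -
  note xs' = tuples_core[OF xs]
  have "map x xs = map (\<lambda>y. (y, y)) (map (\<lambda>a. fst (x a)) xs)"
    using xs hom_core[OF A x] by (auto simp: tuples_def prod_eq_iff)
  moreover have "x (term_op A (lift f) xs) = term_op M (lift f) (map x xs)"
    by (rule alg_hom_term_op[OF A x lift[OF f] xs'])
  moreover have "map (\<lambda>a. fst (x a)) xs \<in> tuples (arity L f) (car N)"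
    by (rule tuples_map[OF xs']) (use hom_in_square[OF x] in \<open>auto simp: mem_Times_iff\<close>)
  ultimately have "fst (x (term_op A (lift f) xs)) = interp N f (map (\<lambda>a. fst (x a)) xs)"
    using lift_eq[OF f] by (simp only:)
  then show ?thesis
    using hom_left[OF A x term_op_in_car[OF A lift[OF f] xs']] by (simp add: core_def)
qed

text \<open>Identities of pairs in \<open>M\<close> transfer to every member of \<open>\<bbbI>\<bbbS>\<bbbP>(M)\<close> in this way: apply
  all homomorphisms to both sides.\<close>

lemma ISP_eqI:
  assumes A: "A \<in> ISP \<Delta> M" and a: "a \<in> car A" and b: "b \<in> car A"
    and eq: "\<And>x. x \<in> alg_hom \<Delta> A M \<Longrightarrow> x a = x b"
  shows "a = b"
  using A[unfolded ISP_iff_separating] a b eq by blast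

lemma in_coreI:
  assumes A: "A \<in> ISP \<Delta> M" and a: "a \<in> car A"
    and diag: "\<And>x. x \<in> alg_hom \<Delta> A M \<Longrightarrow> snd (x a) = fst (x a)"
  shows "a \<in> car (core A)"
proof -
  have alg: "is_alg \<Delta> A" using A by (simp add: ISP_def)
  have "swap A a = a"
    by (rule ISP_eqI[OF A swap_closed[OF alg a] a]) (simp add: hom_swap[OF alg _ a] diag prod_eq_iff)
  then show ?thesis using a by (simp add: core_def)
qed

lemma left_right_in_core:
  assumes A: "A \<in> ISP \<Delta> M" and a: "a \<in> car A"
  shows "left A a \<in> car (core A)" "right A a \<in> car (core A)"
proof -
  have alg: "is_alg \<Delta> A" using A by (simp add: ISP_def)
  show "left A a \<in> car (core A)" "right A a \<in> car (core A)"
    by (rule in_coreI[OF A left_closed[OF alg a]], simp add: hom_left[OF alg _ a])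
      (rule in_coreI[OF A right_closed[OF alg a]], simp add: hom_right[OF alg _ a])
qed

lemma is_alg_core:
  assumes A: "A \<in> ISP \<Delta> M"
  shows "is_alg L (core A)"
  unfolding is_alg_def
proof (intro conjI ballI)
  have alg: "is_alg \<Delta> A" using A by (simp add: ISP_def)
  then obtain a where "a \<in> car A" by (auto simp: is_alg_def)
  then show "car (core A) \<noteq> {}" using left_right_in_core(1)[OF A] by blast
  fix f xs assume f: "f \<in> syms L" and xs: "xs \<in> tuples (arity L f) (car (core A))"
  have "left A (term_op A (lift f) xs) \<in> car (core A)"
    by (rule left_right_in_core(1)[OF A term_op_in_car[OF alg lift[OF f] tuples_core[OF xs]]])
  then show "interp (core A) f xs \<in> car (core A)" by (simp add: core_def)
qed

text \<open>Mutually inverse correspondences between homomorphisms from \<open>A\<close> to the duplicated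
  algebra and homomorphisms from the core of \<open>A\<close> to the original one.\<close>

definition restrict_hom :: "('f arity_term \<times> 'f arity_term, 'c) alg \<Rightarrow> ('c \<Rightarrow> 'n \<times> 'n) \<Rightarrow> 'c \<Rightarrow> 'n" where
  "restrict_hom A x = (\<lambda>a\<in>car (core A). fst (x a))"

definition extend_hom :: "('f arity_term \<times> 'f arity_term, 'c) alg \<Rightarrow> ('c \<Rightarrow> 'n) \<Rightarrow> 'c \<Rightarrow> 'n \<times> 'n" where
  "extend_hom A y = (\<lambda>a\<in>car A. (y (left A a), y (right A a)))"

lemma restrict_hom:
  assumes A: "A \<in> ISP \<Delta> M" and x: "x \<in> alg_hom \<Delta> A M"
  shows "restrict_hom A x \<in> alg_hom L (core A) N"
  unfolding alg_hom_def mem_Collect_eq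
proof (intro conjI ballI)
  have alg: "is_alg \<Delta> A" using A by (simp add: ISP_def)
  show "restrict_hom A x \<in> car (core A) \<rightarrow>\<^sub>E car N"
    using hom_in_square[OF x core_subset] by (auto simp: restrict_hom_def mem_Times_iff)
  fix f xs assume f: "f \<in> syms L" and xs: "xs \<in> tuples (arity L f) (car (core A))"
  have "interp (core A) f xs \<in> car (core A)" using is_alg_core[OF A] f xs by (simp add: is_alg_def)
  then have "restrict_hom A x (interp (core A) f xs) = interp N f (map (\<lambda>a. fst (x a)) xs)"
    using hom_core_interp[OF alg x f xs] by (simp add: restrict_hom_def)
  also have "map (\<lambda>a. fst (x a)) xs = map (restrict_hom A x) xs"
    using xs by (simp add: restrict_hom_def tuples_def subset_iff)
  finally show "restrict_hom A x (interp (core A) f xs) = interp N f (map (restrict_hom A x) xs)" .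
qed

lemma core_in_ISP:
  assumes A: "A \<in> ISP \<Delta> M"
  shows "core A \<in> ISP L N"
  unfolding ISP_iff_separating
proof (intro conjI ballI impI)
  have alg: "is_alg \<Delta> A" using A by (simp add: ISP_def)
  show "is_alg L (core A)" by (rule is_alg_core[OF A])
  fix a b assume a: "a \<in> car (core A)" and b: "b \<in> car (core A)"
    and eq: "\<forall>y\<in>alg_hom L (core A) N. y a = y b"
  show "a = b"
  proof (rule ISP_eqI[OF A core_subset[OF a] core_subset[OF b]])
    fix x assume x: "x \<in> alg_hom \<Delta> A M"
    have "fst (x a) = fst (x b)"
      using eq[THEN bspec, OF restrict_hom[OF A x]] a b by (simp add: restrict_hom_def)
    then show "x a = x b" using hom_core[OF alg x a] hom_core[OF alg x b] by (simp add: prod_eq_iff)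
  qed
qed

text \<open>An operation of the duplicated type is a pair of terms \<open>(t1, t2)\<close>. Its value at elements
  \<open>a\<close> of \<open>A\<close> has as left and right parts the values, in the core, of \<open>t1\<close> and \<open>t2\<close> at the
  interleaved left and right parts of the \<open>a\<close>; this identity can be checked after applying homomorphisms
  into \<open>M\<close>. Hence preserving all terms on the core suffices.\<close>

lemma extend_hom:
  assumes A: "A \<in> ISP \<Delta> M" and y: "y \<in> alg_hom L (core A) N"
  shows "extend_hom A y \<in> alg_hom \<Delta> A M"
  unfolding alg_hom_def mem_Collect_eq
proof (intro conjI ballI)
  have alg: "is_alg \<Delta> A" using A by (simp add: ISP_def)
  note B = is_alg_core[OF A]
  have y_car: "y b \<in> car N" if "b \<in> car (core A)" for b using alg_homD(1)[OF y] that by auto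
  show "extend_hom A y \<in> car A \<rightarrow>\<^sub>E car M"
    using y_car left_right_in_core[OF A] by (auto simp: extend_hom_def)
  fix \<gamma> as assume "\<gamma> \<in> syms \<Delta>" and as: "as \<in> tuples (arity \<Delta> \<gamma>) (car A)"
  then have \<gamma>: "\<gamma> \<in> \<Gamma>" by simp
  then obtain n t1 t2 where \<gamma>': "\<gamma> = ((2 * n, t1), (2 * n, t2))" "arity \<Delta> \<gamma> = n"
    "t1 \<in> terms L (2 * n)" "t2 \<in> terms L (2 * n)"
    using dup_symbolE[OF dup_set] by metis
  let ?a = "interp A \<gamma> as"
  let ?ps = "map (\<lambda>a. (left A a, right A a)) as"
  have a: "?a \<in> car A" using alg \<gamma> as by (auto simp: is_alg_def)
  have ps: "?ps \<in> tuples n (car (core A) \<times> car (core A))"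
    by (rule tuples_map[OF as[unfolded \<gamma>'(2)]]) (use left_right_in_core[OF A] in auto)
  have il: "interleave ?ps \<in> tuples (2 * n) (car (core A))" by (rule interleave_in_tuples[OF ps])
  have core_term: "x (term_op (core A) t (interleave ?ps)) =
      (term_op N t (interleave (map x as)), term_op N t (interleave (map x as)))"
    if x: "x \<in> alg_hom \<Delta> A M" and t: "t \<in> terms L (2 * n)" for x t
  proof -
    have in_core: "term_op (core A) t (interleave ?ps) \<in> car (core A)"
      by (rule term_op_in_car[OF B t il])
    have "fst (x (term_op (core A) t (interleave ?ps))) =
        restrict_hom A x (term_op (core A) t (interleave ?ps))"
      using in_core by (simp add: restrict_hom_def)
    also have "\<dots> = term_op N t (map (restrict_hom A x) (interleave ?ps))"
      by (rule alg_hom_term_op[OF B restrict_hom[OF A x] t il])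
    also have "map (restrict_hom A x) (interleave ?ps) = interleave (map x as)"
    proof -
      have "(restrict_hom A x (left A a), restrict_hom A x (right A a)) = x a" if "a \<in> car A" for a
        using left_right_in_core[OF A that] hom_left[OF alg x that] hom_right[OF alg x that]
        by (simp add: restrict_hom_def)
      then have "map (map_prod (restrict_hom A x) (restrict_hom A x)) ?ps = map x as"
        using as by (auto simp: tuples_def)
      then show ?thesis by (simp only: map_interleave)
    qed
    finally have "fst (x (term_op (core A) t (interleave ?ps))) = term_op N t (interleave (map x as))" .
    then show "x (term_op (core A) t (interleave ?ps)) =
        (term_op N t (interleave (map x as)), term_op N t (interleave (map x as)))"
      using hom_core[OF alg x in_core] by (simp add: prod_eq_iff)
  qed
  have x_a: "x ?a = (term_op N t1 (interleave (map x as)), term_op N t2 (interleave (map x as)))"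
    if "x \<in> alg_hom \<Delta> A M" for x
    using alg_homD(2)[OF that _ as] \<gamma> \<gamma>'(1) by simp
  have in_A: "term_op (core A) t (interleave ?ps) \<in> car A" if "t \<in> terms L (2 * n)" for t
    by (rule core_subset[OF term_op_in_car[OF B that il]])
  have "left A ?a = term_op (core A) t1 (interleave ?ps)"
    by (rule ISP_eqI[OF A left_closed[OF alg a] in_A[OF \<gamma>'(3)]])
      (simp add: hom_left[OF alg _ a] x_a core_term[OF _ \<gamma>'(3)])
  moreover have "right A ?a = term_op (core A) t2 (interleave ?ps)"
    by (rule ISP_eqI[OF A right_closed[OF alg a] in_A[OF \<gamma>'(4)]])
      (simp add: hom_right[OF alg _ a] x_a core_term[OF _ \<gamma>'(4)])
  moreover have "y (term_op (core A) t (interleave ?ps)) = term_op N t (interleave (map (extend_hom A y) as))"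
    if t: "t \<in> terms L (2 * n)" for t
  proof -
    have "map (map_prod y y) ?ps = map (extend_hom A y) as"
      using as by (auto simp: tuples_def extend_hom_def)
    then show ?thesis using alg_hom_term_op[OF B y t il] by (simp only: map_interleave)
  qed
  ultimately show "extend_hom A y ?a = interp M \<gamma> (map (extend_hom A y) as)"
    using a \<gamma>' by (simp add: extend_hom_def[of A y, THEN fun_cong])
qed

lemma extend_restrict:
  assumes A: "A \<in> ISP \<Delta> M" and x: "x \<in> alg_hom \<Delta> A M"
  shows "extend_hom A (restrict_hom A x) = x"
proof -
  have alg: "is_alg \<Delta> A" using A by (simp add: ISP_def)
  have "extend_hom A (restrict_hom A x) a = x a" if a: "a \<in> car A" for a
    using left_right_in_core[OF A a] hom_left[OF alg x a] hom_right[OF alg x a] a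
    by (simp add: restrict_hom_def extend_hom_def)
  moreover have "x a = undefined" if "a \<notin> car A" for a
    using alg_homD(1)[OF x] that by (rule PiE_arb)
  ultimately show ?thesis by (auto simp: extend_hom_def)
qed

section \<open>Transfer of dualities\<close>

context
  fixes G :: "'g language" and R :: "'r language" and Nt :: "('g, 'r, 'n) tstruct"
  assumes ae: "alter_ego L N G R Nt"
begin

abbreviation "Mt \<equiv> tstruct_square Nt"

lemma alter_ego_M: "alter_ego \<Delta> M G R Mt"
  by (rule alter_ego_square[OF dup_set ae])

text \<open>Extension of homomorphisms is a morphism from the dual of the core to the dual of
  \<open>A\<close>, since its coordinate at \<open>a\<close> is the pair of coordinate maps at the left and right parts
  of \<open>a\<close>. It is stated through precomposition, which is how it is used.\<close>

lemma tmor_o_extend: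
  assumes A: "A \<in> ISP \<Delta> M" and \<alpha>: "\<alpha> \<in> tmor G R (functor_D \<Delta> M R Mt A) Z"
  shows "(\<lambda>y\<in>points (functor_D L N R Nt (core A)). \<alpha> (extend_hom A y))
    \<in> tmor G R (functor_D L N R Nt (core A)) Z"
proof -
  let ?B = "core A"
  let ?DA = "functor_D \<Delta> M R Mt A" and ?DB = "functor_D L N R Nt ?B"
  have pA: "points ?DA = alg_hom \<Delta> A M" by (rule points_functor_D[OF alter_ego_M])
  have pB: "points ?DB = alg_hom L ?B N" by (rule points_functor_D[OF ae])
  have tA: "tspace ?DA = subtopology (product_topology (\<lambda>_. tspace Mt) (car A)) (alg_hom \<Delta> A M)"
    and tB: "tspace ?DB = subtopology (product_topology (\<lambda>_. tspace Nt) (car ?B)) (alg_hom L ?B N)"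
    by (simp_all add: functor_D_def substruct_def tstruct_power_def)
  have ext_in: "extend_hom A y \<in> points ?DA" if "y \<in> points ?DB" for y
    using that extend_hom[OF A] by (simp add: pA pB)
  have proj: "continuous_map (tspace ?DB) (tspace Nt) (\<lambda>y. y b)" if "b \<in> car ?B" for b
    unfolding tB using that by (intro continuous_map_from_subtopology continuous_map_product_projection)
  have "continuous_map (tspace ?DB) (tspace Mt) (\<lambda>y. extend_hom A y a)" if a: "a \<in> car A" for a
    using proj[OF left_right_in_core(1)[OF A a]] proj[OF left_right_in_core(2)[OF A a]] a
    by (simp add: extend_hom_def continuous_map_pairwise o_def)
  then have "continuous_map (tspace ?DB) (product_topology (\<lambda>_. tspace Mt) (car A)) (extend_hom A)"
    unfolding continuous_map_componentwise by (auto simp: extend_hom_def)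
  then have cont: "continuous_map (tspace ?DB) (tspace ?DA) (extend_hom A)"
    unfolding tA continuous_map_in_subtopology using ext_in pA by auto
  have ops: "extend_hom A (tops ?DB g ys) = tops ?DA g (map (extend_hom A) ys)" for g ys
    using left_right_in_core[OF A]
    by (auto simp: extend_hom_def functor_D_def substruct_def tstruct_power_def tstruct_square_def o_def)
  have rels: "map (extend_hom A) ys \<in> trels ?DA r" if r: "r \<in> syms R" and ys: "ys \<in> trels ?DB r" for r ys
  proof -
    have ys': "ys \<in> tuples (arity R r) (points ?DB)"
      using is_tstruct_functor_D[OF ae is_alg_core[OF A]] r ys by (auto simp: is_tstruct_def)
    have "alg_hom \<Delta> A M \<subseteq> (\<Pi>\<^sub>E a\<in>car A. points Mt)"
      unfolding alter_egoD(2)[OF alter_ego_M] using alg_homD(1) by blast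
    moreover have "map (extend_hom A) ys \<in> tuples (arity R r) (alg_hom \<Delta> A M)"
      by (rule tuples_map[OF ys']) (use ext_in pA in simp)
    ultimately have "map (extend_hom A) ys \<in> tuples (arity R r) (\<Pi>\<^sub>E a\<in>car A. points Mt)"
      "map (extend_hom A) ys \<in> lists (alg_hom \<Delta> A M)"
      unfolding tuples_def by blast+
    moreover have "map (\<lambda>x. x a) (map (extend_hom A) ys) \<in> trels Mt r" if a: "a \<in> car A" for a
    proof -
      have "map (\<lambda>y. y b) ys \<in> trels Nt r" if "b \<in> car ?B" for b
        using ys that by (simp add: functor_D_def substruct_def tstruct_power_def)
      from this[OF left_right_in_core(1)[OF A a]] this[OF left_right_in_core(2)[OF A a]]
      show ?thesis using a by (simp add: tstruct_square_def extend_hom_def o_def)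
    qed
    ultimately show ?thesis
      by (simp add: functor_D_def substruct_def tstruct_power_def)
  qed
  show ?thesis
    unfolding restrict_in_tmor_iff[OF is_tstruct_functor_D[OF ae is_alg_core[OF A]]]
  proof (intro conjI ballI)
    show "continuous_map (tspace ?DB) (tspace Z) (\<lambda>y. \<alpha> (extend_hom A y))"
      using continuous_map_compose[OF cont, of "tspace Z" \<alpha>] \<alpha> by (simp add: tmor_def o_def)
    show "\<alpha> (extend_hom A (tops ?DB g ys)) = tops Z g (map (\<lambda>y. \<alpha> (extend_hom A y)) ys)"
      if g: "g \<in> syms G" and ys: "ys \<in> tuples (arity G g) (points ?DB)" for g ys
    proof -
      have "map (extend_hom A) ys \<in> tuples (arity G g) (points ?DA)"
        by (rule tuples_map[OF ys ext_in])
      then have "\<alpha> (tops ?DA g (map (extend_hom A) ys)) = tops Z g (map \<alpha> (map (extend_hom A) ys))"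
        using \<alpha> g by (simp add: tmor_def del: map_map)
      then show ?thesis by (simp add: ops o_def)
    qed
    show "map (\<lambda>y. \<alpha> (extend_hom A y)) ys \<in> trels Z r" if r: "r \<in> syms R" and ys: "ys \<in> trels ?DB r" for r ys
    proof -
      have "map \<alpha> (map (extend_hom A) ys) \<in> trels Z r"
        using \<alpha> r rels[OF r ys] by (simp add: tmor_def del: map_map)
      then show ?thesis by (simp add: o_def)
    qed
  qed
qed

text \<open>A morphism \<open>\<alpha>\<close> from the dual of \<open>A\<close> to the square, composed with
  \<open>extend_hom\<close>, has two coordinates, which by the given duality are evaluations at elements
  \<open>b\<close> and \<open>c\<close> of the core. Every homomorphism sends \<open>b\<close> and \<open>c\<close> to diagonal pairs, and
  mixing \<open>b\<close> with \<open>c\<close> combines the first coordinate of one with the second coordinate of the other. So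
  \<open>\<alpha>\<close> is the evaluation at the mixture.\<close>

lemma yields_duality_M:
  assumes dual: "yields_duality TYPE('c) L N G R Nt"
  shows "yields_duality TYPE('c) \<Delta> M G R Mt"
  unfolding yields_duality_def
proof (intro ballI equalityI subsetI)
  fix A :: "('f arity_term \<times> 'f arity_term, 'c) alg"
  assume A: "A \<in> ISP \<Delta> M"
  have alg: "is_alg \<Delta> A" using A by (simp add: ISP_def)
  let ?B = "core A"
  let ?DA = "functor_D \<Delta> M R Mt A" and ?DB = "functor_D L N R Nt ?B"
  have car_E: "car (functor_E M G R Mt ?DA) = tmor G R ?DA Mt"
    "car (functor_E N G R Nt ?DB) = tmor G R ?DB Nt"
    by (simp_all add: functor_E_def subalg_def)
  have pA: "points ?DA = alg_hom \<Delta> A M" by (rule points_functor_D[OF alter_ego_M])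
  have pB: "points ?DB = alg_hom L ?B N" by (rule points_functor_D[OF ae])
  show "\<alpha> \<in> car (functor_E M G R Mt ?DA)" if "\<alpha> \<in> eval_alg \<Delta> M A ` car A" for \<alpha>
    using that eval_alg_in_tmor[OF alter_ego_M alg] by (auto simp: car_E)
  fix \<alpha> assume "\<alpha> \<in> car (functor_E M G R Mt ?DA)"
  then have \<alpha>: "\<alpha> \<in> tmor G R ?DA Mt" by (simp only: car_E)
  have coord: "\<exists>b\<in>car ?B. \<forall>y\<in>alg_hom L ?B N. \<pi> (\<alpha> (extend_hom A y)) = y b" if "\<pi> \<in> {fst, snd}" for \<pi>
  proof -
    have "(\<lambda>y\<in>points ?DB. \<pi> (\<alpha> (extend_hom A y))) \<in> tmor G R ?DB Nt"
      using tmor_o_extend[OF A \<alpha>] that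
      unfolding tmor_square_iff[OF is_tstruct_functor_D[OF ae is_alg_core[OF A]]]
      by (auto cong: restrict_cong)
    also have "tmor G R ?DB Nt = eval_alg L N ?B ` car ?B"
      using dual core_in_ISP[OF A] by (simp add: yields_duality_def car_E(2))
    finally have "(\<lambda>y\<in>points ?DB. \<pi> (\<alpha> (extend_hom A y))) \<in> eval_alg L N ?B ` car ?B" .
    then obtain b where "b \<in> car ?B"
      and eq: "(\<lambda>y\<in>points ?DB. \<pi> (\<alpha> (extend_hom A y))) = eval_alg L N ?B b" by blast
    moreover have "\<pi> (\<alpha> (extend_hom A y)) = y b" if "y \<in> alg_hom L ?B N" for y
      using fun_cong[OF eq, of y] that by (simp add: pB eval_alg_def)
    ultimately show ?thesis by blast
  qed
  obtain b where b: "b \<in> car ?B" "\<And>y. y \<in> alg_hom L ?B N \<Longrightarrow> fst (\<alpha> (extend_hom A y)) = y b"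
    using coord[of fst] by auto
  obtain c where c: "c \<in> car ?B" "\<And>y. y \<in> alg_hom L ?B N \<Longrightarrow> snd (\<alpha> (extend_hom A y)) = y c"
    using coord[of snd] by auto
  let ?a = "mix A b c"
  have bc: "b \<in> car A" "c \<in> car A" using b c by (auto dest: core_subset)
  have "\<alpha> x = eval_alg \<Delta> M A ?a x" for x
  proof (cases "x \<in> alg_hom \<Delta> A M")
    case x: True
    have "\<alpha> x = (restrict_hom A x b, restrict_hom A x c)"
      using b(2)[OF restrict_hom[OF A x]] c(2)[OF restrict_hom[OF A x]]
      by (simp add: extend_restrict[OF A x] prod_eq_iff)
    also have "\<dots> = (fst (x b), snd (x c))"
      using b(1) c(1) hom_core[OF alg x c(1)] by (simp add: restrict_hom_def)
    also have "\<dots> = x ?a" using hom_mix[OF alg x bc] by simp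
    finally show ?thesis using x by (simp add: eval_alg_def)
  next
    case False
    then show ?thesis using \<alpha> pA by (simp add: eval_alg_def tmor_def extensional_def)
  qed
  then show "\<alpha> \<in> eval_alg \<Delta> M A ` car A"
    using mix_closed[OF alg bc] by blast
qed

text \<open>A homomorphism \<open>u\<close> from the dual \<open>E\<close> of \<open>X\<close> to \<open>M\<close> induces the homomorphism
  \<open>\<beta> \<mapsto> fst (u (\<beta>, \<beta>))\<close> on the dual of \<open>X\<close> with respect to \<open>N\<close>, because the diagonal
  pairs of morphisms carry the operations of the core of \<open>E\<close>. The given duality makes it the evaluation at a
  point, and \<open>u\<close> is the evaluation at the same point because every morphism into the square is a mixture of
  two diagonal ones.\<close>

lemma eval_struct_surj_M:
  fixes X :: "('g, 'r, 'd) tstruct"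
  assumes X: "X \<in> IScP G R Nt"
    and surj: "eval_struct G R Nt X ` points X = points (functor_D L N R Nt (functor_E N G R Nt X))"
  shows "eval_struct G R Mt X ` points X = points (functor_D \<Delta> M R Mt (functor_E M G R Mt X))"
proof (intro equalityI subsetI)
  let ?E = "functor_E M G R Mt X" and ?EN = "functor_E N G R Nt X"
  have X': "is_tstruct G R X" and ne: "tmor G R X Nt \<noteq> {}"
    using X IScP_iff_separating[OF alter_egoD(3,4)[OF ae]] by auto
  have pts: "points (functor_D \<Delta> M R Mt ?E) = alg_hom \<Delta> ?E M"
    "points (functor_D L N R Nt ?EN) = alg_hom L ?EN N"
    by (rule points_functor_D[OF alter_ego_M] points_functor_D[OF ae])+
  have car_E: "car ?E = tmor G R X Mt" "car ?EN = tmor G R X Nt"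
    by (simp_all add: functor_E_def subalg_def)
  note ev = eval_struct_in_alg_hom[OF alter_ego_M X']
  show "u \<in> points (functor_D \<Delta> M R Mt ?E)" if "u \<in> eval_struct G R Mt X ` points X" for u
    using that ev by (auto simp: pts)
  fix u assume "u \<in> points (functor_D \<Delta> M R Mt ?E)"
  then have u: "u \<in> alg_hom \<Delta> ?E M" by (simp only: pts)
  have ne_M: "tmor G R X Mt \<noteq> {}" using tmor_pair[OF X'] ne by blast
  have alg: "is_alg \<Delta> ?E" by (rule is_alg_functor_E[OF alter_ego_M X' ne_M])
  \<comment> \<open>Point evaluations are homomorphisms and separate the morphisms, so \<open>E\<close> is in \<open>\<bbbI>\<bbbS>\<bbbP>(M)\<close>.\<close>
  have E_eqI: "\<alpha> = \<beta>" if "\<alpha> \<in> car ?E" "\<beta> \<in> car ?E"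
    and eq: "\<And>x. x \<in> points X \<Longrightarrow> eval_struct G R Mt X x \<alpha> = eval_struct G R Mt X x \<beta>" for \<alpha> \<beta>
  proof (rule extensionalityI[of _ "points X"])
    show "\<alpha> \<in> extensional (points X)" "\<beta> \<in> extensional (points X)"
      using that by (auto simp: car_E tmor_def)
    show "\<alpha> x = \<beta> x" if "x \<in> points X" for x
      using eq[OF that] \<open>\<alpha> \<in> car ?E\<close> \<open>\<beta> \<in> car ?E\<close> by (simp add: eval_struct_def car_E)
  qed
  have E: "?E \<in> ISP \<Delta> M"
    unfolding ISP_iff_separating using alg ev by (blast intro: E_eqI)
  define dg where "dg = (\<lambda>\<beta>. \<lambda>x\<in>points X. (\<beta> x :: 'n, \<beta> x))"
  have dg_E: "dg \<beta> \<in> car ?E" if "\<beta> \<in> tmor G R X Nt" for \<beta>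
    using tmor_pair[OF X' that that] by (simp add: dg_def car_E)
  have ev_dg: "eval_struct G R Mt X x (dg \<beta>) = (\<beta> x, \<beta> x)" if "x \<in> points X" "\<beta> \<in> tmor G R X Nt" for x \<beta>
    using dg_E[OF that(2)] that(1) by (simp add: eval_struct_def car_E dg_def)
  have dg_core: "dg \<beta> \<in> car (core ?E)" if \<beta>: "\<beta> \<in> tmor G R X Nt" for \<beta>
  proof -
    have "swap ?E (dg \<beta>) = dg \<beta>"
      by (rule E_eqI[OF swap_closed[OF alg dg_E[OF \<beta>]] dg_E[OF \<beta>]])
        (simp add: hom_swap[OF alg ev dg_E[OF \<beta>]] ev_dg[OF _ \<beta>])
    then show ?thesis using dg_E[OF \<beta>] by (simp add: core_def)
  qed
  define w where "w = (\<lambda>\<beta>\<in>tmor G R X Nt. fst (u (dg \<beta>)))"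
  have "w \<in> alg_hom L ?EN N"
    unfolding alg_hom_def mem_Collect_eq
  proof (intro conjI ballI)
    show "w \<in> car ?EN \<rightarrow>\<^sub>E car N"
      using hom_in_square[OF u dg_E] by (auto simp: w_def car_E mem_Times_iff)
    fix f \<beta>s assume f: "f \<in> syms L" and "\<beta>s \<in> tuples (arity L f) (car ?EN)"
    then have \<beta>s: "\<beta>s \<in> tuples (arity L f) (tmor G R X Nt)" by (simp only: car_E)
    let ?\<beta> = "interp ?EN f \<beta>s"
    have \<beta>: "?\<beta> \<in> tmor G R X Nt"
      using tmor_closed_under_interp[OF ae X' f \<beta>s] by (simp add: functor_E_def subalg_def)
    have dgs: "map dg \<beta>s \<in> tuples (arity L f) (car (core ?E))"
      by (rule tuples_map[OF \<beta>s dg_core])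
    have in_core: "interp (core ?E) f (map dg \<beta>s) \<in> car (core ?E)"
      using is_alg_core[OF E] f dgs by (simp add: is_alg_def)
    have "dg ?\<beta> = interp (core ?E) f (map dg \<beta>s)"
    proof (rule E_eqI[OF dg_E[OF \<beta>] core_subset[OF in_core]])
      fix x assume x: "x \<in> points X"
      have "map (\<lambda>\<alpha>. fst (eval_struct G R Mt X x \<alpha>)) (map dg \<beta>s) = map (\<lambda>\<beta>. \<beta> x) \<beta>s"
        using \<beta>s ev_dg[OF x] by (auto simp: tuples_def)
      then have "eval_struct G R Mt X x (interp (core ?E) f (map dg \<beta>s)) =
          (interp N f (map (\<lambda>\<beta>. \<beta> x) \<beta>s), interp N f (map (\<lambda>\<beta>. \<beta> x) \<beta>s))"
        using hom_core_interp[OF alg ev[OF x] f dgs] by (simp only:)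
      moreover have "?\<beta> x = interp N f (map (\<lambda>\<beta>. \<beta> x) \<beta>s)"
        using x by (simp add: functor_E_def subalg_def alg_power_def)
      ultimately show "eval_struct G R Mt X x (dg ?\<beta>) =
          eval_struct G R Mt X x (interp (core ?E) f (map dg \<beta>s))"
        using ev_dg[OF x \<beta>] by simp
    qed
    then have "w ?\<beta> = interp N f (map (\<lambda>a. fst (u a)) (map dg \<beta>s))"
      using \<beta> hom_core_interp[OF alg u f dgs] by (simp add: w_def)
    also have "map (\<lambda>a. fst (u a)) (map dg \<beta>s) = map w \<beta>s"
      using \<beta>s by (auto simp: w_def tuples_def)
    finally show "w ?\<beta> = interp N f (map w \<beta>s)" .
  qed
  then obtain x where x: "x \<in> points X" and w: "w = eval_struct G R Nt X x"
    using surj by (auto simp: pts)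
  have "u \<alpha> = eval_struct G R Mt X x \<alpha>" for \<alpha>
  proof (cases "\<alpha> \<in> tmor G R X Mt")
    case \<alpha>: True
    define \<beta> where "\<beta> = (\<lambda>x\<in>points X. fst (\<alpha> x))"
    define \<gamma> where "\<gamma> = (\<lambda>x\<in>points X. snd (\<alpha> x))"
    have \<beta>: "\<beta> \<in> tmor G R X Nt" and \<gamma>: "\<gamma> \<in> tmor G R X Nt"
      using \<alpha> by (auto simp: tmor_square_iff[OF X'] \<beta>_def \<gamma>_def)
    have u_dg: "u (dg \<beta>') = (\<beta>' x, \<beta>' x)" if \<beta>': "\<beta>' \<in> tmor G R X Nt" for \<beta>'
      using fun_cong[OF w, of \<beta>'] \<beta>' hom_core[OF alg u dg_core[OF \<beta>']]
      by (simp add: w_def eval_struct_def prod_eq_iff)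
    have "\<alpha> = mix ?E (dg \<beta>) (dg \<gamma>)"
    proof (rule E_eqI)
      show "\<alpha> \<in> car ?E" using \<alpha> by (simp add: car_E)
      show "mix ?E (dg \<beta>) (dg \<gamma>) \<in> car ?E" by (rule mix_closed[OF alg dg_E[OF \<beta>] dg_E[OF \<gamma>]])
      fix z assume z: "z \<in> points X"
      show "eval_struct G R Mt X z \<alpha> = eval_struct G R Mt X z (mix ?E (dg \<beta>) (dg \<gamma>))"
        unfolding hom_mix[OF alg ev[OF z] dg_E[OF \<beta>] dg_E[OF \<gamma>]] ev_dg[OF z \<beta>] ev_dg[OF z \<gamma>]
        using z \<alpha> by (simp add: eval_struct_def \<beta>_def \<gamma>_def)
    qed
    then have "u \<alpha> = (\<beta> x, \<gamma> x)"
      using hom_mix[OF alg u dg_E[OF \<beta>] dg_E[OF \<gamma>]] u_dg[OF \<beta>] u_dg[OF \<gamma>] by simp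
    then show ?thesis using x \<alpha> by (simp add: \<beta>_def \<gamma>_def eval_struct_def)
  next
    case False
    then have "u \<alpha> = undefined" using alg_homD(1)[OF u] by (intro PiE_arb) (auto simp: car_E)
    then show ?thesis using False by (simp add: eval_struct_def)
  qed
  then show "u \<in> eval_struct G R Mt X ` points X" using x by blast
qed

lemma yields_full_duality_M:
  assumes full: "yields_full_duality TYPE('c) TYPE('d) L N G R Nt"
  shows "yields_full_duality TYPE('c) TYPE('d) \<Delta> M G R Mt"
  unfolding yields_full_duality_def IScP_square[OF alter_egoD(3,4)[OF ae]]
proof (intro conjI ballI)
  show "yields_duality TYPE('c) \<Delta> M G R Mt"
    using full by (intro yields_duality_M) (simp add: yields_full_duality_def)
  fix X :: "('g, 'r, 'd) tstruct" assume "X \<in> IScP G R Nt"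
  with full show "eval_struct G R Mt X ` points X = points (functor_D \<Delta> M R Mt (functor_E M G R Mt X))"
    by (intro eval_struct_surj_M) (simp_all add: yields_full_duality_def)
qed

lemma yields_strong_duality_M:
  assumes strong: "yields_strong_duality TYPE('c) TYPE('d) L N G R Nt"
  shows "yields_strong_duality TYPE('c) TYPE('d) \<Delta> M G R Mt"
  using strong yields_full_duality_M[where ?'c = 'c and ?'d = 'd]
    injective_in_IScP_square[OF alter_egoD(3,4)[OF ae], where ?'d = 'd]
  by (simp add: yields_strong_duality_def)

end

end

lemma duplication_obtains:
  assumes N: "is_alg L N" and \<Gamma>: "dup_set L \<Gamma>" and dup: "duplicates L \<Gamma> N"
  obtains v s lift where "duplication L \<Gamma> N v s lift"
proof -
  obtain v where v: "v \<in> terms (dup_language \<Gamma>) 2" "\<forall>a\<in>car N. \<forall>b\<in>car N. \<forall>c\<in>car N. \<forall>d\<in>car N.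
      term_op (dup_alg N) v [(a, b), (c, d)] = (a, d)"
    using dup by (auto simp: duplicates_def)
  obtain s where s: "s \<in> terms (dup_language \<Gamma>) 1" "\<forall>a\<in>car N. \<forall>b\<in>car N.
      term_op (dup_alg N) s [(a, b)] = (b, a)"
    using dup by (auto simp: duplicates_def)
  have "\<forall>f\<in>syms L. \<exists>t. t \<in> terms (dup_language \<Gamma>) (arity L f) \<and>
      (\<forall>xs\<in>tuples (arity L f) (car N).
        fst (term_op (dup_alg N) t (map (\<lambda>x. (x, x)) xs)) = interp N f xs)"
    using dup by (auto simp: duplicates_def)
  from bchoice[OF this] obtain lift where lift: "\<forall>f\<in>syms L. lift f \<in> terms (dup_language \<Gamma>) (arity L f) \<and>
      (\<forall>xs\<in>tuples (arity L f) (car N).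
        fst (term_op (dup_alg N) (lift f) (map (\<lambda>x. (x, x)) xs)) = interp N f xs)" ..
  have "duplication L \<Gamma> N v s lift"
  proof
    show "is_alg L N" "dup_set L \<Gamma>" "v \<in> terms (dup_language \<Gamma>) 2" "s \<in> terms (dup_language \<Gamma>) 1"
      by (fact N \<Gamma> v(1) s(1))+
  qed (use v(2) s(2) lift in \<open>auto simp: mem_Times_iff\<close>)
  then show ?thesis by (rule that)
qed

theorem theorem3p1:
  fixes \<Sigma> :: "'f language" and N :: "('f, 'n) alg"
    and \<Gamma> :: "('f arity_term \<times> 'f arity_term) set"
    and G :: "'g language" and R :: "'r language" and Nt :: "('g, 'r, 'n) tstruct"
  assumes "dup_set \<Sigma> \<Gamma>"
    and "duplicates \<Sigma> \<Gamma> N"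
    and "alter_ego \<Sigma> N G R Nt"
    and "yields_duality TYPE('c) \<Sigma> N G R Nt"
  shows "alter_ego (dup_language \<Gamma>) (dup_alg N) G R (tstruct_square Nt) \<and>
    yields_duality TYPE('c) (dup_language \<Gamma>) (dup_alg N) G R (tstruct_square Nt) \<and>
    (IScP G R (tstruct_square Nt) :: ('g, 'r, 'd) tstruct set) = IScP G R Nt \<and>
    (yields_full_duality TYPE('c) TYPE('d) \<Sigma> N G R Nt \<longrightarrow>
     yields_full_duality TYPE('c) TYPE('d) (dup_language \<Gamma>) (dup_alg N) G R (tstruct_square Nt)) \<and>
    (yields_strong_duality TYPE('c) TYPE('d) \<Sigma> N G R Nt \<longrightarrow>
     yields_strong_duality TYPE('c) TYPE('d) (dup_language \<Gamma>) (dup_alg N) G R (tstruct_square Nt))"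
proof -
  note ae = assms(3)
  obtain v s lift where "duplication \<Sigma> \<Gamma> N v s lift"
    using duplication_obtains[OF alter_egoD(1)[OF ae] assms(1,2)] .
  then interpret duplication \<Sigma> \<Gamma> N v s lift .
  show ?thesis
    by (intro conjI impI alter_ego_M yields_duality_M IScP_square yields_full_duality_M
        yields_strong_duality_M alter_egoD(3,4)[OF ae] ae assms(4))
qed

end
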